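(* Let $(\Omega,\mathcal F,\mathbb P)$ be a complete probability space, let $\mathcal H$ be a real Hilbert space (not necessarily separable), and let $v\in L^2(\Omega,\mathcal H)$. Then $v$ admits a Karhunen-Loève expansion (KLE).
   Context: A function $v:\Omega\to\mathcal H$ is simple if $\mathbb P$-a.e. $v(\omega)=\sum_{n=1}^N \mathbb I_{E_n}(\omega)e_n$ with $E_n\in\mathcal F$, $e_n\in\mathcal H$; it is Bochner measurable if there are simple functions $v_n$ with $\|v_n(\omega)-v(\omega)\|_{\mathcal H}\to 0$ for $\mathbb P$-a.e. $\omega$. $L^2(\Omega,\mathcal H)$ is the Hilbert space of ($\mathbb P$-a.e. equivalence classes of) Bochner measurable $v:\Omega\to\mathcal H$ with $\int_\Omega\|v(\omega)\|_{\mathcal H}^2\,d\mathbb P<\infty$, with inner product $\langle u,v\rangle_{L^2(\Omega,\mathcal H)}=\int_\Omega\langle u(\omega),v(\omega)\rangle_{\mathcal H}\,d\mathbb P$. $L^2(\Omega)$ is the space of (classes of) real-valued square-integrable $\mathcal F$-measurable functions. $\mathbb E(v)=\int_\Omega v\,d\mathbb P\in\mathcal H$ is the Bochner integral. Definition (KLE). A Bochner integrable $v:\Omega\to\mathcal H$ admits a KLE if $$v=\mathbb E(v)+\sum_{r=1}^R\lambda_r^{1/2}Y_r\phi_r$$ where: (1) $R\in\{0,1,2,\dots\}\cup\{\aleph_0\}$, and if $R=\aleph_0$ the sum converges in the $L^2(\Omega,\mathcal H)$ norm; (2) $\lambda_r\in(0,\infty)$, $\lambda_1\ge\lambda_2\ge\cdots$,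 and $\sum_{r=1}^R\lambda_r=\|v-\mathbb E(v)\|^2_{L^2(\Omega,\mathcal H)}$; (3) $\{Y_r\}_{r=1}^R$ is an orthonormal set in $L^2(\Omega)$ with each $Y_r$ of mean zero; (4) $\{\phi_r\}_{r=1}^R$ is an orthonormal set in $\mathcal H$. Here $Y_r\phi_r$ denotes the function $\omega\mapsto Y_r(\omega)\phi_r$, and the empty sum ($R=0$) is $0$. *)

theory Defs
  imports "HOL-Probability.Probability"
begin

text \<open>
  The Bochner integral of HOL-Analysis is restricted to second countable (hence separable)
  codomains, so the vector-valued notions are introduced here for arbitrary normed spaces.
  Elements of the various function spaces are represented by functions, and equality of
  classes by equality almost everywhere.
\<close>

subsection \<open>Bochner measurability and the Bochner integral\<close>

definition bochner_simple :: "'a measure \<Rightarrow> ('a \<Rightarrow> 'b::real_normed_vector) \<Rightarrow> bool" where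
  "bochner_simple M v \<longleftrightarrow>
     (\<exists>(N::nat) E e. (\<forall>n\<in>{1..N}. E n \<in> sets M) \<and>
        (AE \<omega> in M. v \<omega> = (\<Sum>n=1..N. indicator (E n) \<omega> *\<^sub>R e n)))"

definition bochner_measurable :: "'a measure \<Rightarrow> ('a \<Rightarrow> 'b::real_normed_vector) \<Rightarrow> bool" where
  "bochner_measurable M v \<longleftrightarrow>
     (\<exists>s :: nat \<Rightarrow> 'a \<Rightarrow> 'b. (\<forall>n. bochner_simple M (s n)) \<and>
        (AE \<omega> in M. (\<lambda>n. norm (s n \<omega> - v \<omega>)) \<longlonglongrightarrow> 0))"

text \<open>
  The approximants below are everywhere (not just almost everywhere) finitely valued and
  measurable; this makes the library integral of simple functions available and does not
  affect the resulting integral. On a complete measure space the integrand in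
  \<open>bochner_approx\<close> is measurable whenever \<open>f\<close> is Bochner measurable.
\<close>

definition bochner_approx ::
  "'a measure \<Rightarrow> ('a \<Rightarrow> 'b::real_normed_vector) \<Rightarrow> (nat \<Rightarrow> 'a \<Rightarrow> 'b) \<Rightarrow> bool" where
  "bochner_approx M f s \<longleftrightarrow>
     (\<forall>i. Bochner_Integration.simple_bochner_integrable M (s i)) \<and>
     (\<lambda>i. \<integral>\<^sup>+\<omega>. ennreal (norm (f \<omega> - s i \<omega>)) \<partial>M) \<longlonglongrightarrow> 0"

definition bochner_integrable :: "'a measure \<Rightarrow> ('a \<Rightarrow> 'b::real_normed_vector) \<Rightarrow> bool" where
  "bochner_integrable M f \<longleftrightarrow> bochner_measurable M f \<and> (\<exists>s. bochner_approx M f s)"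

definition bochner_integral :: "'a measure \<Rightarrow> ('a \<Rightarrow> 'b::real_normed_vector) \<Rightarrow> 'b" where
  "bochner_integral M f =
     (THE x. \<exists>s. bochner_approx M f s \<and> (\<lambda>i. Bochner_Integration.simple_bochner_integral M (s i)) \<longlonglongrightarrow> x)"

text \<open>Agreement with the library integral where the latter is defined.\<close>

lemma bochner_integral_eq_lebesgue_integral:
  fixes f :: "'a \<Rightarrow> 'b::{real_normed_vector, second_countable_topology}"
  assumes "integrable M f"
  shows "bochner_integral M f = integral\<^sup>L M f"
proof -
  have "(\<exists>s. bochner_approx M f s \<and> (\<lambda>i. Bochner_Integration.simple_bochner_integral M (s i)) \<longlonglongrightarrow> x)
          \<longleftrightarrow> has_bochner_integral M f x" for x
    using borel_measurable_integrable[OF assms]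
    by (auto simp: has_bochner_integral.simps bochner_approx_def)
  moreover have "\<exists>x. has_bochner_integral M f x"
    using assms by (auto simp: integrable.simps)
  ultimately show ?thesis
    by (simp add: bochner_integral_def lebesgue_integral_def)
qed

subsection \<open>The square-integrable function spaces\<close>

definition L2_space :: "'a measure \<Rightarrow> ('a \<Rightarrow> 'b::real_inner) set" where
  "L2_space M = {v. bochner_measurable M v \<and> (\<integral>\<^sup>+\<omega>. ennreal ((norm (v \<omega>))\<^sup>2) \<partial>M) < \<infinity>}"

definition L2_real :: "'a measure \<Rightarrow> ('a \<Rightarrow> real) set" where
  "L2_real M = {Y. Y \<in> borel_measurable M \<and> (\<integral>\<^sup>+\<omega>. ennreal ((Y \<omega>)\<^sup>2) \<partial>M) < \<infinity>}"

definition L2_inner :: "'a measure \<Rightarrow> ('a \<Rightarrow> 'b::real_inner) \<Rightarrow> ('a \<Rightarrow> 'b) \<Rightarrow> real" where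
  "L2_inner M u v = (\<integral>\<omega>. u \<omega> \<bullet> v \<omega> \<partial>M)"

definition L2_norm :: "'a measure \<Rightarrow> ('a \<Rightarrow> 'b::real_inner) \<Rightarrow> real" where
  "L2_norm M v = sqrt (L2_inner M v v)"

text \<open>
  Membership is required explicitly because \<open>L2_norm\<close> takes the value 0 on functions that are
  not square integrable.
\<close>

definition L2_tendsto ::
  "'a measure \<Rightarrow> (nat \<Rightarrow> 'a \<Rightarrow> 'b::real_inner) \<Rightarrow> ('a \<Rightarrow> 'b) \<Rightarrow> bool" where
  "L2_tendsto M s u \<longleftrightarrow>
     (\<forall>n. s n \<in> L2_space M) \<and> u \<in> L2_space M \<and>
     (\<lambda>n. L2_norm M (\<lambda>\<omega>. s n \<omega> - u \<omega>)) \<longlonglongrightarrow> 0"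

subsection \<open>Karhunen-Loeve expansions\<close>

text \<open>\<open>R = \<infinity>\<close> stands for countably infinitely many terms; indices start at 1.\<close>

definition KLE_index :: "enat \<Rightarrow> nat set" where
  "KLE_index R = {r. 1 \<le> r \<and> enat r \<le> R}"

definition is_KLE ::
  "'a measure \<Rightarrow> ('a \<Rightarrow> 'h::real_inner) \<Rightarrow>
   enat \<Rightarrow> (nat \<Rightarrow> real) \<Rightarrow> (nat \<Rightarrow> 'a \<Rightarrow> real) \<Rightarrow> (nat \<Rightarrow> 'h) \<Rightarrow> bool" where
  "is_KLE M v R lam Y \<phi> \<longleftrightarrow>
     (case R of
        enat n \<Rightarrow>
          (AE \<omega> in M. v \<omega> =
             bochner_integral M v + (\<Sum>r=1..n. sqrt (lam r) *\<^sub>R (Y r \<omega> *\<^sub>R \<phi> r)))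
      | \<infinity> \<Rightarrow>
          L2_tendsto M (\<lambda>n \<omega>. \<Sum>r=1..n. sqrt (lam r) *\<^sub>R (Y r \<omega> *\<^sub>R \<phi> r))
            (\<lambda>\<omega>. v \<omega> - bochner_integral M v)) \<and>
     (\<forall>r\<in>KLE_index R. 0 < lam r) \<and>
     (\<forall>r\<in>KLE_index R. \<forall>s\<in>KLE_index R. r \<le> s \<longrightarrow> lam s \<le> lam r) \<and>
     (lam has_sum (L2_norm M (\<lambda>\<omega>. v \<omega> - bochner_integral M v))\<^sup>2) (KLE_index R) \<and>
     (\<forall>r\<in>KLE_index R. Y r \<in> L2_real M \<and> (\<integral>\<omega>. Y r \<omega> \<partial>M) = 0) \<and>
     (\<forall>r\<in>KLE_index R. \<forall>s\<in>KLE_index R. L2_inner M (Y r) (Y s) = (if r = s then 1 else 0)) \<and>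
     (\<forall>r\<in>KLE_index R. \<forall>s\<in>KLE_index R. \<phi> r \<bullet> \<phi> s = (if r = s then 1 else 0))"

definition admits_KLE :: "'a measure \<Rightarrow> ('a \<Rightarrow> 'h::real_inner) \<Rightarrow> bool" where
  "admits_KLE M v \<longleftrightarrow> bochner_integrable M v \<and> (\<exists>R lam Y \<phi>. is_KLE M v R lam Y \<phi>)"

end

theory Submission
  imports Defs
begin

text \<open>
  Let \<open>w\<close> be the centred function \<open>v - E v\<close> and consider on the Hilbert space the covariance form
  \<open>q g h = E ((w \<bullet> g) (w \<bullet> h))\<close>. The expansion is the singular value decomposition of the operator
  \<open>h \<mapsto> w \<bullet> h\<close>: if \<open>e\<^sub>r\<close> are orthonormal eigenvectors of \<open>q\<close> with eigenvalues \<open>l\<^sub>r\<close>, then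
  \<open>Y\<^sub>r = (w \<bullet> e\<^sub>r) / sqrt l\<^sub>r\<close> satisfies \<open>E (Y\<^sub>r Y\<^sub>s) = q e\<^sub>r e\<^sub>s / sqrt (l\<^sub>r l\<^sub>s)\<close>, so that the \<open>Y\<^sub>r\<close> are
  orthonormal, and the partial sums of the expansion are the orthogonal projections of \<open>w \<omega>\<close> onto the
  spans of the first \<open>e\<^sub>r\<close>. Each \<open>Y\<^sub>r\<close> has mean zero because \<open>w\<close> is centred.
  
  Three points carry the proof.
  
  First, the form \<open>q\<close> is compact (\<open>compact_psd_form_covariance\<close>). Bochner measurability confines
  almost all values of \<open>w\<close> to the closure of a countable set, so a bounded sequence \<open>X\<close> has a subsequence
  along which \<open>w \<omega> \<bullet> X n\<close> converges for almost all \<open>\<omega>\<close>, and dominated convergence applies. This is why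
  the space itself need not be separable.
  
  Second, a compact positive semidefinite form is diagonalised by maximising it greedily over unit
  vectors in successive orthogonal complements. Existence of maximisers (\<open>ex_maximiser\<close>) follows from
  two parallelogram laws. The eigenvalues decrease to \<open>0\<close>, and \<open>eigval n\<close> bounds the form on the
  complement of the first \<open>n\<close> eigenvectors.
  
  Third, the remainders of the expansion tend to \<open>0\<close> in mean square
  (\<open>integral_norm_remainder_tendsto_0\<close>). For a simple function \<open>t\<close> near \<open>w\<close>, the inner product of the
  remainder with \<open>t\<close> is a finite combination of terms that the eigenvalue bound makes small. By
  Pythagoras the second moment of the remainder is \<open>E \<parallel>w\<parallel>\<^sup>2 - (\<Sum>r<n. l\<^sub>r)\<close>, which yields at once
  \<open>\<Sum>l\<^sub>r = E \<parallel>w\<parallel>\<^sup>2\<close>, the mean-square convergence, and the exact finite expansion when only finitely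
  many eigenvalues are positive.
  
  The mean \<open>E v\<close> enters only through its weak characterisation \<open>E v \<bullet> h = E (v \<bullet> h)\<close>
  (\<open>bochner_integral_weak\<close>).
\<close>

section \<open>Diagonalisation of compact positive semidefinite forms\<close>

definition orthocomp :: "'h::real_inner set \<Rightarrow> 'h set" where
  "orthocomp S = {x. \<forall>s\<in>S. x \<bullet> s = 0}"

lemma orthocomp_add: "x \<in> orthocomp S \<Longrightarrow> y \<in> orthocomp S \<Longrightarrow> x + y \<in> orthocomp S"
  and orthocomp_scaleR: "x \<in> orthocomp S \<Longrightarrow> c *\<^sub>R x \<in> orthocomp S"
  by (simp_all add: orthocomp_def inner_add_left)

lemma closed_orthocomp: "closed (orthocomp S)"
proof -
  have "orthocomp S = (\<Inter>s\<in>S. {x. x \<bullet> s = 0})"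
    by (auto simp: orthocomp_def)
  moreover have "closed {x. x \<bullet> s = 0}" for s :: 'a
    by (intro closed_Collect_eq continuous_intros)
  ultimately show ?thesis
    by auto
qed

text \<open>
  A positive semidefinite form is the square of a seminorm, \<open>q x x\<close> being the squared seminorm
  of \<open>x\<close>. Compactness of the operator representing \<open>q\<close> is expressed without that operator:
  every sequence in the unit ball has a subsequence that is Cauchy in the seminorm.
\<close>

locale compact_psd_form = bounded_bilinear q
  for q :: "'h::{real_inner, complete_space} \<Rightarrow> 'h \<Rightarrow> real" +
  assumes sym: "q x y = q y x"
    and psd: "0 \<le> q x x"
    and form_compact: "(\<And>n::nat. norm (X n) \<le> 1) \<Longrightarrow>
      \<exists>\<rho>::nat \<Rightarrow> nat. strict_mono \<rho> \<and>
        (\<forall>e>0. \<exists>N. \<forall>m\<ge>N. \<forall>n\<ge>N. q (X (\<rho> m) - X (\<rho> n)) (X (\<rho> m) - X (\<rho> n)) < e)"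
begin

lemma parallelogram: "q (x + y) (x + y) + q (x - y) (x - y) = 2 * q x x + 2 * q y y"
  by (simp add: add_left add_right diff_left diff_right)

lemma quadratic_scaleR: "q (c *\<^sub>R x) (c *\<^sub>R x) = c\<^sup>2 * q x x"
  by (simp add: scaleR_left scaleR_right power2_eq_square)

text \<open>
  A unit vector at which the Rayleigh quotient \<open>q x x / \<parallel>x\<parallel>\<^sup>2\<close> attains a positive maximum over the
  orthogonal complement of \<open>S\<close>; it is an eigenvector of the operator representing the
  restriction of \<open>q\<close>.
\<close>

definition maximiser :: "'h set \<Rightarrow> 'h \<Rightarrow> bool" where
  "maximiser S \<phi> \<longleftrightarrow> norm \<phi> = 1 \<and> \<phi> \<in> orthocomp S \<and> 0 < q \<phi> \<phi> \<and>
     (\<forall>x\<in>orthocomp S. q x x \<le> q \<phi> \<phi> * (norm x)\<^sup>2)"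

text \<open>
  The supremum \<open>l\<close> of the form over the unit sphere is attained because a maximising sequence
  \<open>y\<close> that is Cauchy in the seminorm is Cauchy in norm. Indeed, by the parallelogram law for
  \<open>q\<close>, the value of the form at \<open>y m + y n\<close> is close to \<open>4 * l\<close>. As the form is at most \<open>l\<close> times
  the squared norm, \<open>\<parallel>y m + y n\<parallel>\<^sup>2\<close> is nearly \<open>4\<close>, and the parallelogram law for the norm leaves almost nothing for \<open>\<parallel>y m - y n\<parallel>\<^sup>2\<close>.
\<close>

lemma ex_maximiser:
  assumes x0: "x0 \<in> orthocomp S" "0 < q x0 x0"
  shows "\<exists>\<phi>. maximiser S \<phi>"
proof -
  define A where "A = (\<lambda>x. q x x) ` {x \<in> orthocomp S. norm x = 1}"
  define l where "l = Sup A"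
  obtain K where K: "\<And>x y. norm (q x y) \<le> norm x * norm y * K"
    using bounded by blast
  have bdd: "bdd_above A"
  proof (rule bdd_aboveI)
    fix a assume "a \<in> A"
    then obtain x where "a = q x x" "norm x = 1" by (auto simp: A_def)
    then show "a \<le> K" using K[of x x] by simp
  qed
  have upper: "q x x \<le> l * (norm x)\<^sup>2" if x: "x \<in> orthocomp S" for x
  proof (cases "x = 0")
    case True
    then show ?thesis by (simp add: zero_left)
  next
    case False
    define u where "u = (1 / norm x) *\<^sub>R x"
    have "u \<in> orthocomp S" "norm u = 1"
      using False x by (auto simp: u_def intro: orthocomp_scaleR)
    then have "q u u \<le> l"
      unfolding l_def A_def by (intro cSup_upper bdd[unfolded A_def]) auto
    have "x = norm x *\<^sub>R u"
      using False by (simp add: u_def)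
    then have "q x x = (norm x)\<^sup>2 * q u u"
      by (metis quadratic_scaleR)
    moreover have "(norm x)\<^sup>2 * q u u \<le> (norm x)\<^sup>2 * l"
      using \<open>q u u \<le> l\<close> by (rule mult_left_mono) simp
    ultimately show ?thesis
      by (simp only: mult.commute)
  qed
  have lpos: "0 < l"
  proof (rule ccontr)
    assume "\<not> 0 < l"
    then have "l * (norm x0)\<^sup>2 \<le> 0"
      by (simp add: mult_nonpos_nonneg)
    with upper[OF x0(1)] x0(2) show False by linarith
  qed
  have ne: "A \<noteq> {}"
  proof -
    have "x0 \<noteq> 0" using x0 by (auto simp: zero_left)
    then have "(1 / norm x0) *\<^sub>R x0 \<in> {x \<in> orthocomp S. norm x = 1}"
      using x0 by (auto intro: orthocomp_scaleR)
    then show ?thesis unfolding A_def by blast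
  qed
  have "\<exists>x. x \<in> orthocomp S \<and> norm x = 1 \<and> l - inverse (Suc n) < q x x" for n
  proof -
    have "l - inverse (Suc n) < Sup A"
      unfolding l_def by simp
    then show ?thesis
      using less_cSup_iff[OF ne bdd] unfolding A_def by auto
  qed
  then obtain x where x: "\<And>n. x n \<in> orthocomp S" "\<And>n. norm (x n) = 1"
    "\<And>n. l - inverse (Suc n) < q (x n) (x n)"
    by metis
  obtain \<rho> :: "nat \<Rightarrow> nat" where \<rho>: "strict_mono \<rho>"
    "\<And>e. e > 0 \<Longrightarrow> \<exists>N. \<forall>m\<ge>N. \<forall>n\<ge>N. q (x (\<rho> m) - x (\<rho> n)) (x (\<rho> m) - x (\<rho> n)) < e"
    using form_compact[of x] x(2) by auto
  define y where "y = x \<circ> \<rho>"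
  have y: "y n \<in> orthocomp S" "norm (y n) = 1" "l - inverse (Suc n) < q (y n) (y n)" for n
  proof -
    show "l - inverse (Suc n) < q (y n) (y n)"
    proof -
      have "inverse (real (Suc (\<rho> n))) \<le> inverse (real (Suc n))"
        using seq_suble[OF \<rho>(1), of n] by (intro le_imp_inverse_le) auto
      then show ?thesis
        using x(3)[of "\<rho> n"] unfolding y_def comp_apply by linarith
    qed
  qed (auto simp: y_def x)
  have "Cauchy y"
  proof (rule metric_CauchyI)
    fix e :: real assume e: "0 < e"
    define d where "d = l * e\<^sup>2 / 8"
    have d: "0 < d" using e lpos by (simp add: d_def)
    obtain N1 where N1: "\<And>m n. m \<ge> N1 \<Longrightarrow> n \<ge> N1 \<Longrightarrow> q (y m - y n) (y m - y n) < d"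
      using \<rho>(2)[OF d] unfolding y_def by auto
    obtain N2 where N2: "inverse (real (Suc N2)) < d"
      using reals_Archimedean d by blast
    have near: "l - d < q (y n) (y n)" if "n \<ge> N2" for n
    proof -
      have "inverse (real (Suc n)) \<le> inverse (real (Suc N2))"
        using that by (intro le_imp_inverse_le) auto
      then show ?thesis
        using y(3)[of n] N2 by linarith
    qed
    have "dist (y m) (y n) < e" if mn: "m \<ge> max N1 N2" "n \<ge> max N1 N2" for m n
    proof -
      have "4 * l - 4 * d - d < q (y m + y n) (y m + y n)"
        using near[of m] near[of n] N1[of m n] mn parallelogram[of "y m" "y n"] by simp
      also have "\<dots> \<le> l * (norm (y m + y n))\<^sup>2"
        by (intro upper orthocomp_add y)
      also have "(norm (y m + y n))\<^sup>2 = 4 - (norm (y m - y n))\<^sup>2"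
        using y(2)[of m] y(2)[of n]
        by (simp add: norm_eq_1 power2_norm_eq_inner inner_simps inner_commute)
      finally have "l * (norm (y m - y n))\<^sup>2 < 5 * d"
        by (simp add: algebra_simps)
      also have "\<dots> \<le> l * e\<^sup>2"
        using lpos by (simp add: d_def)
      finally have "(norm (y m - y n))\<^sup>2 < e\<^sup>2"
        using lpos by simp
      then show ?thesis
        using e by (simp add: dist_norm power2_less_imp_less)
    qed
    then show "\<exists>N. \<forall>m\<ge>N. \<forall>n\<ge>N. dist (y m) (y n) < e" by blast
  qed
  then obtain \<phi> where \<phi>: "y \<longlonglongrightarrow> \<phi>"
    by (auto dest!: Cauchy_convergent simp: convergent_def)
  have "\<phi> \<in> orthocomp S"
    by (rule closed_sequentially[OF closed_orthocomp y(1) \<phi>])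
  moreover have "norm \<phi> = 1"
    using tendsto_norm[OF \<phi>] y(2) by (simp add: LIMSEQ_const_iff)
  moreover have "l \<le> q \<phi> \<phi>"
  proof (rule LIMSEQ_le)
    show "(\<lambda>n. l - inverse (Suc n)) \<longlonglongrightarrow> l"
      using LIMSEQ_inverse_real_of_nat_add_minus[of l] by simp
    show "(\<lambda>n. q (y n) (y n)) \<longlonglongrightarrow> q \<phi> \<phi>"
      by (intro tendsto \<phi>)
    show "\<exists>N. \<forall>n\<ge>N. l - inverse (Suc n) \<le> q (y n) (y n)"
      by (intro exI allI impI less_imp_le y(3))
  qed
  moreover have "q \<phi> \<phi> \<le> l"
    using upper[of \<phi>] calculation(1,2) by simp
  ultimately show ?thesis
    using upper lpos unfolding maximiser_def by (intro exI[of _ \<phi>]) auto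
qed

text \<open>
  First variation: along \<open>\<phi> + t x\<close> the inequality between the form and \<open>q \<phi> \<phi>\<close> times the
  squared norm is an equality at \<open>t = 0\<close>, so its linear term in \<open>t\<close>, which is \<open>2 t q \<phi> x\<close>
  because \<open>x\<close> is orthogonal to \<open>\<phi>\<close>, must vanish.
\<close>

lemma maximiser_form_orthogonal:
  assumes \<phi>: "maximiser S \<phi>" and x: "x \<in> orthocomp S" "x \<bullet> \<phi> = 0"
  shows "q \<phi> x = 0"
proof -
  define l b c where "l = q \<phi> \<phi>" and "b = q \<phi> x" and "c = l * (norm x)\<^sup>2"
  have le: "2 * t * b \<le> t\<^sup>2 * c" for t
  proof -
    have "q (\<phi> + t *\<^sub>R x) (\<phi> + t *\<^sub>R x) \<le> l * (norm (\<phi> + t *\<^sub>R x))\<^sup>2"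
      using \<phi> x unfolding maximiser_def l_def by (auto intro: orthocomp_add orthocomp_scaleR)
    moreover have "(norm (\<phi> + t *\<^sub>R x))\<^sup>2 = 1 + t\<^sup>2 * (norm x)\<^sup>2"
      using x(2) \<phi> unfolding maximiser_def norm_eq_1 power2_norm_eq_inner
      by (simp add: inner_simps inner_commute power2_eq_square)
    moreover have "q (\<phi> + t *\<^sub>R x) (\<phi> + t *\<^sub>R x) = l + 2 * t * b + t\<^sup>2 * q x x"
      using sym[of x \<phi>]
      by (simp add: add_left add_right scaleR_left scaleR_right l_def b_def power2_eq_square algebra_simps)
    moreover have "0 \<le> t\<^sup>2 * q x x"
      using psd by simp
    ultimately show ?thesis
      by (simp add: c_def algebra_simps)
  qed
  have "c \<ge> 0"
    using psd by (simp add: c_def l_def)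
  \<comment> \<open>If \<open>b \<noteq> 0\<close>, the bound fails most clearly near \<open>t = b / c\<close>; the added \<open>1\<close> covers \<open>c = 0\<close>.\<close>
  define t where "t = b / (c + 1)"
  have b: "b = t * (c + 1)"
    using \<open>c \<ge> 0\<close> by (simp add: t_def)
  have "2 * t * (t * (c + 1)) \<le> t\<^sup>2 * c"
    using le[of t] unfolding b .
  then have "t\<^sup>2 * (c + 2) \<le> 0"
    by (simp add: power2_eq_square algebra_simps)
  then have "t = 0"
    using \<open>c \<ge> 0\<close> by (simp add: mult_le_0_iff)
  then have "b = 0"
    unfolding b by simp
  then show ?thesis
    by (simp add: b_def)
qed

text \<open>
  Eigenvectors are picked greedily. The value \<open>0\<close> pads the sequence once the form vanishes on the
  remaining orthogonal complement, so that finite and infinite rank are treated alike.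
\<close>

definition next_vector :: "'h set \<Rightarrow> 'h" where
  "next_vector S = (if \<exists>\<phi>. maximiser S \<phi> then SOME \<phi>. maximiser S \<phi> else 0)"

primrec chosen :: "nat \<Rightarrow> 'h set" where
  "chosen 0 = {}"
| "chosen (Suc n) = insert (next_vector (chosen n)) (chosen n)"

definition eigvec :: "nat \<Rightarrow> 'h" where
  "eigvec n = next_vector (chosen n)"

definition eigval :: "nat \<Rightarrow> real" where
  "eigval n = q (eigvec n) (eigvec n)"

lemma chosen_eq: "chosen n = eigvec ` {..<n}"
  by (induction n) (auto simp: eigvec_def lessThan_Suc)

lemma eigvec_maximiser: "eigvec n = 0 \<or> maximiser (chosen n) (eigvec n)"
  unfolding eigvec_def next_vector_def by (auto intro: someI_ex)

lemma eigval_nonneg: "0 \<le> eigval n"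
  by (simp add: eigval_def psd)

lemma eigvec_eq_0_iff: "eigvec n = 0 \<longleftrightarrow> eigval n = 0"
  using eigvec_maximiser[of n] by (auto simp: eigval_def maximiser_def zero_left)

lemma norm_eigvec: "0 < eigval n \<Longrightarrow> norm (eigvec n) = 1"
  using eigvec_maximiser[of n] by (auto simp: eigval_def maximiser_def zero_left)

lemma eigvec_in_orthocomp: "eigvec n \<in> orthocomp (chosen n)"
  using eigvec_maximiser[of n] by (auto simp: maximiser_def orthocomp_def)

text \<open>
  This bound is what makes the greedy choice useful: together with \<open>eigval n \<longlonglongrightarrow> 0\<close> it says that the
  form is uniformly small far out in the chain of complements.
\<close>

lemma form_le_eigval:
  assumes x: "x \<in> orthocomp (chosen n)"
  shows "q x x \<le> eigval n * (norm x)\<^sup>2"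
proof (cases "eigvec n = 0")
  case True
  \<comment> \<open>The zero vector is chosen only when no candidate is left, since a maximiser has norm 1.\<close>
  have "\<not> (\<exists>\<phi>. maximiser (chosen n) \<phi>)"
  proof
    assume ex: "\<exists>\<phi>. maximiser (chosen n) \<phi>"
    then have "maximiser (chosen n) (eigvec n)"
      unfolding eigvec_def next_vector_def by (auto intro: someI_ex)
    with True show False by (simp add: maximiser_def)
  qed
  with ex_maximiser[OF x] have "q x x \<le> 0"
    by force
  then show ?thesis
    using eigval_nonneg[of n] by (smt (verit) mult_nonneg_nonneg zero_le_power2)
next
  case False
  then show ?thesis
    using eigvec_maximiser[of n] x by (auto simp: maximiser_def eigval_def)
qed

lemma eigvec_orthogonal: "m \<noteq> n \<Longrightarrow> eigvec m \<bullet> eigvec n = 0"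
proof (induction m n rule: linorder_wlog)
  case (le m n)
  then have "eigvec m \<in> chosen n" by (auto simp: chosen_eq)
  then show ?case
    using eigvec_in_orthocomp[of n] by (simp add: orthocomp_def inner_commute)
qed (simp add: inner_commute)

text \<open>
  The later of two eigenvectors was a candidate at the earlier choice, so the first variation
  applies to it.
\<close>

lemma form_eigvec_orthogonal: "m \<noteq> n \<Longrightarrow> q (eigvec m) (eigvec n) = 0"
proof (induction m n rule: linorder_wlog)
  case (le m n)
  have "eigvec n \<in> orthocomp (chosen m)"
    using eigvec_in_orthocomp[of n] le by (auto simp: orthocomp_def chosen_eq)
  moreover have "eigvec n \<bullet> eigvec m = 0"
    using le by (auto intro: eigvec_orthogonal)
  ultimately show ?case
    using eigvec_maximiser[of m] maximiser_form_orthogonal by (auto simp: zero_left)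
qed (simp add: sym)

lemma decseq_eigval: "decseq eigval"
proof (rule decseq_SucI)
  fix n
  have "eigvec (Suc n) \<in> orthocomp (chosen n)"
    using eigvec_in_orthocomp[of "Suc n"] by (auto simp: orthocomp_def)
  then have "eigval (Suc n) \<le> eigval n * (norm (eigvec (Suc n)))\<^sup>2"
    unfolding eigval_def[of "Suc n"] by (rule form_le_eigval)
  also have "\<dots> \<le> eigval n"
    using eigvec_maximiser[of "Suc n"] eigval_nonneg[of n] by (auto simp: maximiser_def)
  finally show "eigval (Suc n) \<le> eigval n" .
qed

text \<open>
  For distinct indices the eigenvectors are orthogonal with respect to \<open>q\<close>, so their squared
  distance in the seminorm is \<open>eigval m + eigval n\<close>; compactness makes this arbitrarily small.
\<close>

lemma eigval_tendsto_0: "eigval \<longlonglongrightarrow> 0"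
proof -
  have "norm (eigvec n) \<le> 1" for n
    using eigvec_maximiser[of n] by (auto simp: maximiser_def)
  then obtain \<rho> :: "nat \<Rightarrow> nat" where \<rho>: "strict_mono \<rho>" "\<And>e. e > 0 \<Longrightarrow> \<exists>N. \<forall>m\<ge>N. \<forall>n\<ge>N.
      q (eigvec (\<rho> m) - eigvec (\<rho> n)) (eigvec (\<rho> m) - eigvec (\<rho> n)) < e"
    using form_compact[of eigvec] by auto
  show ?thesis
  proof (rule LIMSEQ_I)
    fix e :: real assume "0 < e"
    then obtain N where "\<forall>m\<ge>N. \<forall>n\<ge>N.
      q (eigvec (\<rho> m) - eigvec (\<rho> n)) (eigvec (\<rho> m) - eigvec (\<rho> n)) < e"
      using \<rho>(2) by blast
    then have "q (eigvec (\<rho> N) - eigvec (\<rho> (Suc N))) (eigvec (\<rho> N) - eigvec (\<rho> (Suc N))) < e"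
      by auto
    moreover have "\<rho> N \<noteq> \<rho> (Suc N)"
      using \<rho>(1) strict_mono_Suc_iff less_irrefl by metis
    ultimately have "eigval (\<rho> N) + eigval (\<rho> (Suc N)) < e"
      by (simp add: diff_left diff_right form_eigvec_orthogonal eigval_def)
    then have "eigval (\<rho> N) < e"
      using eigval_nonneg[of "\<rho> (Suc N)"] by simp
    then show "\<exists>N. \<forall>n\<ge>N. norm (eigval n - 0) < e"
      using decseqD[OF decseq_eigval] eigval_nonneg by (metis abs_of_nonneg diff_zero order_le_less_trans real_norm_def)
  qed
qed

text \<open>
  The orthogonal projection onto the complement of the first \<open>n\<close> eigenvectors.
\<close>

definition remainder :: "nat \<Rightarrow> 'h \<Rightarrow> 'h" where
  "remainder n x = x - (\<Sum>r<n. (x \<bullet> eigvec r) *\<^sub>R eigvec r)"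

lemma remainder_in_orthocomp: "remainder n x \<in> orthocomp (chosen n)"
proof -
  have "remainder n x \<bullet> eigvec s = 0" if "s < n" for s
  proof (cases "eigvec s = 0")
    case False
    then have "eigvec s \<bullet> eigvec s = 1"
      using norm_eigvec eigvec_eq_0_iff eigval_nonneg[of s] by (metis norm_eq_1 order_le_less)
    moreover have "(\<Sum>r<n. (x \<bullet> eigvec r) * (eigvec r \<bullet> eigvec s))
        = (\<Sum>r<n. if r = s then (x \<bullet> eigvec s) * (eigvec s \<bullet> eigvec s) else 0)"
      by (intro sum.cong refl) (simp add: eigvec_orthogonal)
    ultimately show ?thesis
      using that by (simp add: remainder_def inner_diff_left inner_sum_left)
  qed simp
  then show ?thesis by (auto simp: orthocomp_def chosen_eq)
qed

lemma remainder_inner_commute: "remainder n x \<bullet> y = x \<bullet> remainder n y"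
  by (simp add: remainder_def inner_diff_left inner_diff_right inner_sum_left inner_sum_right
      inner_commute mult.commute)

lemma remainder_inner_self: "(norm (remainder n x))\<^sup>2 = remainder n x \<bullet> x"
proof -
  have "remainder n x \<bullet> eigvec r = 0" if "r < n" for r
    using remainder_in_orthocomp[of n x] that by (auto simp: orthocomp_def chosen_eq)
  then have "remainder n x \<bullet> (\<Sum>r<n. (x \<bullet> eigvec r) *\<^sub>R eigvec r) = 0"
    by (simp add: inner_sum_right)
  moreover have "(norm (remainder n x))\<^sup>2
      = remainder n x \<bullet> (x - (\<Sum>r<n. (x \<bullet> eigvec r) *\<^sub>R eigvec r))"
    by (metis power2_norm_eq_inner remainder_def)
  ultimately show ?thesis
    by (simp add: inner_diff_right)
qed

lemma norm_remainder_le: "norm (remainder n x) \<le> norm x"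
proof -
  have "norm (remainder n x) * norm (remainder n x) \<le> norm (remainder n x) * norm x"
    using remainder_inner_self[of n x] norm_cauchy_schwarz[of "remainder n x" x]
    by (simp add: power2_eq_square)
  then show ?thesis
    by (metis mult_le_cancel_left_pos norm_ge_zero norm_le_zero_iff not_le order.trans order_le_less)
qed

lemma norm_remainder_Pythagoras: "(norm (remainder n x))\<^sup>2 = (norm x)\<^sup>2 - (\<Sum>r<n. (x \<bullet> eigvec r)\<^sup>2)"
proof -
  have "x \<bullet> remainder n x = x \<bullet> x - (\<Sum>r<n. (x \<bullet> eigvec r) * (x \<bullet> eigvec r))"
    by (simp add: remainder_def inner_diff_right inner_sum_right)
  then show ?thesis
    unfolding remainder_inner_self power2_norm_eq_inner[of x] inner_commute[of "remainder n x" x]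
    by (simp add: power2_eq_square)
qed

lemma form_remainder_le: "q (remainder n x) (remainder n x) \<le> eigval n * (norm x)\<^sup>2"
proof -
  have "q (remainder n x) (remainder n x) \<le> eigval n * (norm (remainder n x))\<^sup>2"
    by (rule form_le_eigval[OF remainder_in_orthocomp])
  also have "\<dots> \<le> eigval n * (norm x)\<^sup>2"
    by (intro mult_left_mono power_mono norm_remainder_le eigval_nonneg) simp
  finally show ?thesis .
qed

end

section \<open>Bochner measurability and the Bochner integral\<close>

text \<open>
  Simple functions in the sense of measure theory are stable under composition with arbitrary
  maps, which is why they are used from here on in place of sums of indicators.
\<close>

lemma bochner_simple_iff:
  "bochner_simple M v \<longleftrightarrow> (\<exists>g. simple_function M g \<and> (AE \<omega> in M. v \<omega> = g \<omega>))"
proof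
  assume "bochner_simple M v"
  then obtain N :: nat and E e where E: "\<forall>n\<in>{1..N}. E n \<in> sets M"
    and ae: "AE \<omega> in M. v \<omega> = (\<Sum>n=1..N. indicator (E n) \<omega> *\<^sub>R e n)"
    unfolding bochner_simple_def by blast
  have "simple_function M (\<lambda>\<omega>. indicator (E n) \<omega> *\<^sub>R e n)" if "n \<in> {1..N}" for n
    using E that by (intro simple_function_compose1[where g = "\<lambda>t. t *\<^sub>R e n"]) auto
  then have "simple_function M (\<lambda>\<omega>. \<Sum>n=1..N. indicator (E n) \<omega> *\<^sub>R e n)"
    by (rule simple_function_sum)
  with ae show "\<exists>g. simple_function M g \<and> (AE \<omega> in M. v \<omega> = g \<omega>)"
    by blast
next
  assume "\<exists>g. simple_function M g \<and> (AE \<omega> in M. v \<omega> = g \<omega>)"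
  then obtain g where g: "simple_function M g" and ae: "AE \<omega> in M. v \<omega> = g \<omega>"
    by blast
  define N where "N = card (g ` space M)"
  obtain e where e: "bij_betw e {1..N} (g ` space M)"
    using ex_bij_betw_nat_finite_1[OF simple_functionD(1)[OF g]] unfolding N_def by blast
  define E where "E n = g -` {e n} \<inter> space M" for n
  have "E n \<in> sets M" for n
    unfolding E_def by (rule simple_functionD(2)[OF g])
  moreover have "AE \<omega> in M. v \<omega> = (\<Sum>n=1..N. indicator (E n) \<omega> *\<^sub>R e n)"
    using ae AE_space
  proof eventually_elim
    case (elim \<omega>)
    have "(\<Sum>n=1..N. indicator (E n) \<omega> *\<^sub>R e n)
        = (\<Sum>n=1..N. indicator {e n} (g \<omega>) *\<^sub>R e n)"
      using elim by (intro sum.cong refl) (auto simp: E_def indicator_def)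
    also have "\<dots> = (\<Sum>y\<in>g ` space M. indicator {y} (g \<omega>) *\<^sub>R y)"
      by (rule sum.reindex_bij_betw[OF e])
    also have "\<dots> = (\<Sum>y\<in>g ` space M. if g \<omega> = y then y else 0)"
      by (intro sum.cong refl) auto
    also have "\<dots> = g \<omega>"
      using elim simple_functionD(1)[OF g] by simp
    finally show ?case
      using elim by simp
  qed
  ultimately show "bochner_simple M v"
    unfolding bochner_simple_def by blast
qed

lemma bochner_measurable_iff:
  "bochner_measurable M v \<longleftrightarrow>
     (\<exists>s. (\<forall>n. simple_function M (s n)) \<and> (AE \<omega> in M. (\<lambda>n. s n \<omega>) \<longlonglongrightarrow> v \<omega>))"
proof
  assume "bochner_measurable M v"
  then obtain s where s: "\<And>n. bochner_simple M (s n)"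
    and lim: "AE \<omega> in M. (\<lambda>n. norm (s n \<omega> - v \<omega>)) \<longlonglongrightarrow> 0"
    unfolding bochner_measurable_def by blast
  from s obtain g where g: "\<And>n. simple_function M (g n)" "\<And>n. AE \<omega> in M. s n \<omega> = g n \<omega>"
    unfolding bochner_simple_iff by metis
  have "AE \<omega> in M. \<forall>n. s n \<omega> = g n \<omega>"
    using g(2) by (simp add: AE_all_countable)
  with lim have "AE \<omega> in M. (\<lambda>n. g n \<omega>) \<longlonglongrightarrow> v \<omega>"
  proof eventually_elim
    case (elim \<omega>)
    then show ?case by (simp add: tendsto_norm_zero_iff LIM_zero_iff)
  qed
  with g(1) show "\<exists>s. (\<forall>n. simple_function M (s n)) \<and> (AE \<omega> in M. (\<lambda>n. s n \<omega>) \<longlonglongrightarrow> v \<omega>)"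
    by blast
next
  assume "\<exists>s. (\<forall>n. simple_function M (s n)) \<and> (AE \<omega> in M. (\<lambda>n. s n \<omega>) \<longlonglongrightarrow> v \<omega>)"
  then obtain s where s: "\<And>n. simple_function M (s n)"
    and lim: "AE \<omega> in M. (\<lambda>n. s n \<omega>) \<longlonglongrightarrow> v \<omega>"
    by blast
  have "bochner_simple M (s n)" for n
    unfolding bochner_simple_iff using s by blast
  moreover have "AE \<omega> in M. (\<lambda>n. norm (s n \<omega> - v \<omega>)) \<longlonglongrightarrow> 0"
    using lim by eventually_elim (simp add: tendsto_norm_zero_iff LIM_zero_iff)
  ultimately show "bochner_measurable M v"
    unfolding bochner_measurable_def by blast
qed

lemma bochner_measurable_continuous:
  assumes v: "bochner_measurable M v" and g: "continuous_on UNIV g"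
  shows "bochner_measurable M (\<lambda>\<omega>. g (v \<omega>))"
proof -
  obtain s where s: "\<And>n. simple_function M (s n)" "AE \<omega> in M. (\<lambda>n. s n \<omega>) \<longlonglongrightarrow> v \<omega>"
    using v unfolding bochner_measurable_iff by blast
  have "simple_function M (\<lambda>\<omega>. g (s n \<omega>))" for n
    by (rule simple_function_compose1[OF s(1)])
  moreover have "AE \<omega> in M. (\<lambda>n. g (s n \<omega>)) \<longlonglongrightarrow> g (v \<omega>)"
    using s(2) by eventually_elim (rule continuous_on_tendsto_compose[OF g], auto)
  ultimately show ?thesis
    unfolding bochner_measurable_iff by (intro exI[of _ "\<lambda>n \<omega>. g (s n \<omega>)"] conjI allI)
qed

text \<open>
  Completeness of the measure enters here: a limit that exists only almost everywhere agrees
  almost everywhere with the measurable function \<open>lim\<close>, and is therefore measurable itself.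
\<close>

lemma (in complete_measure) borel_measurable_AE_lim:
  fixes f :: "nat \<Rightarrow> 'a \<Rightarrow> real"
  assumes [measurable]: "\<And>n. f n \<in> borel_measurable M"
    and lim: "AE \<omega> in M. (\<lambda>n. f n \<omega>) \<longlonglongrightarrow> g \<omega>"
  shows "g \<in> borel_measurable M"
proof (rule measurableI)
  fix A :: "real set" assume [measurable]: "A \<in> sets borel"
  have sets: "(\<lambda>\<omega>. lim (\<lambda>n. f n \<omega>)) -` A \<inter> space M \<in> sets M"
    by measurable
  have ae: "AE \<omega> in M. \<omega> \<in> (\<lambda>\<omega>. lim (\<lambda>n. f n \<omega>)) -` A \<inter> space M \<longleftrightarrow> \<omega> \<in> g -` A \<inter> space M"
    using lim by eventually_elim (simp add: limI)
  show "g -` A \<inter> space M \<in> sets M"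
    by (rule in_sets_AE[OF ae sets]) auto
qed simp

text \<open>
  The codomain need not be separable, so sums and inner products of Borel functions into it may
  fail to be measurable. All measurability is therefore obtained for real-valued functions of
  one Bochner measurable and one simple argument.
\<close>

lemma (in complete_measure) borel_measurable_bochner_simple:
  fixes g :: "'b::real_normed_vector \<Rightarrow> 'c \<Rightarrow> real"
  assumes v: "bochner_measurable M v" and t: "simple_function M t"
    and g: "\<And>y. continuous_on UNIV (\<lambda>x. g x y)"
  shows "(\<lambda>\<omega>. g (v \<omega>) (t \<omega>)) \<in> borel_measurable M"
proof -
  obtain s where s: "\<And>n. simple_function M (s n)" "AE \<omega> in M. (\<lambda>n. s n \<omega>) \<longlonglongrightarrow> v \<omega>"
    using v unfolding bochner_measurable_iff by blast
  show ?thesis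
  proof (rule borel_measurable_AE_lim)
    show "(\<lambda>\<omega>. g (s n \<omega>) (t \<omega>)) \<in> borel_measurable M" for n
      by (rule borel_measurable_simple_function[OF simple_function_compose2[OF s(1) t]])
    show "AE \<omega> in M. (\<lambda>n. g (s n \<omega>) (t \<omega>)) \<longlonglongrightarrow> g (v \<omega>) (t \<omega>)"
      using s(2) by eventually_elim (rule continuous_on_tendsto_compose[OF g], auto)
  qed
qed

lemma (in complete_measure) borel_measurable_bochner:
  fixes g :: "'b::real_normed_vector \<Rightarrow> real"
  assumes "bochner_measurable M v" and "continuous_on UNIV g"
  shows "(\<lambda>\<omega>. g (v \<omega>)) \<in> borel_measurable M"
  using borel_measurable_bochner_simple[OF assms(1) simple_function_const, of "\<lambda>x y. g x" "()"] assms(2)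
  by simp

text \<open>
  Approximants can be cut off where their norm exceeds \<open>2 \<parallel>v\<parallel>\<close>; at points with \<open>v \<omega> \<noteq> 0\<close> the
  cut is eventually inactive. The result supplies the majorants for dominated convergence.
\<close>

lemma (in complete_measure) bochner_measurable_dominated_simple:
  assumes v: "bochner_measurable M v"
  shows "\<exists>t. (\<forall>n. simple_function M (t n)) \<and> (\<forall>n \<omega>. norm (t n \<omega>) \<le> 2 * norm (v \<omega>)) \<and>
    (AE \<omega> in M. (\<lambda>n. t n \<omega>) \<longlonglongrightarrow> v \<omega>)"
proof -
  obtain s where s: "\<And>n. simple_function M (s n)" "AE \<omega> in M. (\<lambda>n. s n \<omega>) \<longlonglongrightarrow> v \<omega>"
    using v unfolding bochner_measurable_iff by blast
  define t where "t n \<omega> = (if norm (s n \<omega>) \<le> 2 * norm (v \<omega>) then s n \<omega> else 0)" for n \<omega>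
  have [measurable]: "(\<lambda>\<omega>. norm (v \<omega>)) \<in> borel_measurable M"
    by (rule borel_measurable_bochner[OF v]) (intro continuous_intros)
  have [measurable]: "(\<lambda>\<omega>. norm (s n \<omega>)) \<in> borel_measurable M" for n
    by (rule borel_measurable_simple_function[OF simple_function_compose1[OF s(1)]])
  have "simple_function M (t n)" for n
    unfolding t_def by (intro simple_function_If s simple_function_const) measurable
  moreover have "norm (t n \<omega>) \<le> 2 * norm (v \<omega>)" for n \<omega>
    by (simp add: t_def)
  moreover have "AE \<omega> in M. (\<lambda>n. t n \<omega>) \<longlonglongrightarrow> v \<omega>"
    using s(2)
  proof eventually_elim
    case (elim \<omega>)
    show ?case
    proof (cases "v \<omega> = 0")
      case True
      then show ?thesis by (simp add: t_def if_distrib cong: if_cong)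
    next
      case False
      have "eventually (\<lambda>n. norm (s n \<omega>) < 2 * norm (v \<omega>)) sequentially"
        using False by (intro order_tendstoD(2)[OF tendsto_norm[OF elim]]) simp
      then have "eventually (\<lambda>n. s n \<omega> = t n \<omega>) sequentially"
        by eventually_elim (simp add: t_def)
      then show ?thesis
        using elim by (rule Lim_transform_eventually[rotated])
    qed
  qed
  ultimately show ?thesis by blast
qed

locale complete_prob_space = prob_space + complete_measure
begin

lemma simple_bochner_integrable_iff:
  "Bochner_Integration.simple_bochner_integrable M f \<longleftrightarrow> simple_function M f"
  by (simp add: Bochner_Integration.simple_bochner_integrable.simps)

text \<open>
  Testing against a vector \<open>h\<close> reduces the Bochner integral to a Lebesgue integral. All
  approximating sequences thus have the same weak limit, which makes the Bochner integral
  well defined.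
\<close>

lemma bochner_approx_weak_limit:
  fixes v :: "'a \<Rightarrow> 'h::real_inner"
  assumes v: "bochner_measurable M v" and int: "integrable M (\<lambda>\<omega>. norm (v \<omega>))"
    and s: "bochner_approx M v s"
  shows "(\<lambda>i. Bochner_Integration.simple_bochner_integral M (s i) \<bullet> h) \<longlonglongrightarrow> (\<integral>\<omega>. v \<omega> \<bullet> h \<partial>M)"
proof -
  have simple: "simple_function M (s i)" for i
    using s by (simp add: bochner_approx_def simple_bochner_integrable_iff)
  have [measurable]: "(\<lambda>\<omega>. v \<omega> \<bullet> h) \<in> borel_measurable M"
    "(\<lambda>\<omega>. norm (v \<omega>)) \<in> borel_measurable M"
    using borel_measurable_bochner[OF v, of "\<lambda>x. x \<bullet> h"] borel_measurable_bochner[OF v, of norm]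
    by (simp_all add: continuous_intros)
  have [measurable]: "(\<lambda>\<omega>. norm (v \<omega> - s i \<omega>)) \<in> borel_measurable M" for i
    using borel_measurable_bochner_simple[OF v simple, of "\<lambda>x y. norm (x - y)"]
    by (simp add: continuous_intros)
  have vh: "integrable M (\<lambda>\<omega>. v \<omega> \<bullet> h)"
    by (rule Bochner_Integration.integrable_bound[OF integrable_mult_left[OF int, of "norm h"]])
      (auto simp: Cauchy_Schwarz_ineq2)
  have sbi: "Bochner_Integration.simple_bochner_integrable M (\<lambda>\<omega>. s i \<omega> \<bullet> h)" for i
    unfolding simple_bochner_integrable_iff by (rule simple_function_compose1[OF simple])
  have sh: "integrable M (\<lambda>\<omega>. s i \<omega> \<bullet> h)" for i
    using has_bochner_integral_simple_bochner_integrable[OF sbi] by (rule integrable.intros)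
  have eq: "Bochner_Integration.simple_bochner_integral M (s i) \<bullet> h = (\<integral>\<omega>. s i \<omega> \<bullet> h \<partial>M)" for i
  proof -
    have "linear (\<lambda>x. x \<bullet> h)"
      by (rule bounded_linear.linear[OF bounded_linear_inner_left])
    moreover have "Bochner_Integration.simple_bochner_integrable M (s i)"
      unfolding simple_bochner_integrable_iff by (rule simple)
    ultimately have "Bochner_Integration.simple_bochner_integral M (\<lambda>\<omega>. s i \<omega> \<bullet> h)
        = Bochner_Integration.simple_bochner_integral M (s i) \<bullet> h"
      by (rule Bochner_Integration.simple_bochner_integral_linear)
    then show ?thesis
      unfolding simple_bochner_integrable_eq_integral[OF sbi] by (rule sym)
  qed
  have bound: "ennreal \<bar>(\<integral>\<omega>. v \<omega> \<bullet> h \<partial>M) - (\<integral>\<omega>. s i \<omega> \<bullet> h \<partial>M)\<bar>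
      \<le> ennreal (norm h) * (\<integral>\<^sup>+\<omega>. ennreal (norm (v \<omega> - s i \<omega>)) \<partial>M)" for i
  proof -
    have "(\<integral>\<omega>. v \<omega> \<bullet> h \<partial>M) - (\<integral>\<omega>. s i \<omega> \<bullet> h \<partial>M) = (\<integral>\<omega>. v \<omega> \<bullet> h - s i \<omega> \<bullet> h \<partial>M)"
      by (simp add: vh sh)
    then have "ennreal \<bar>(\<integral>\<omega>. v \<omega> \<bullet> h \<partial>M) - (\<integral>\<omega>. s i \<omega> \<bullet> h \<partial>M)\<bar>
        \<le> (\<integral>\<^sup>+\<omega>. ennreal (norm (v \<omega> \<bullet> h - s i \<omega> \<bullet> h)) \<partial>M)"
      using integral_norm_bound_ennreal[OF Bochner_Integration.integrable_diff[OF vh sh]] by simp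
    also have "\<dots> \<le> (\<integral>\<^sup>+\<omega>. ennreal (norm h) * ennreal (norm (v \<omega> - s i \<omega>)) \<partial>M)"
    proof (rule nn_integral_mono)
      fix \<omega>
      have "norm (v \<omega> \<bullet> h - s i \<omega> \<bullet> h) \<le> norm h * norm (v \<omega> - s i \<omega>)"
        using Cauchy_Schwarz_ineq2[of "v \<omega> - s i \<omega>" h] by (simp add: inner_diff_left mult.commute)
      then show "ennreal (norm (v \<omega> \<bullet> h - s i \<omega> \<bullet> h))
          \<le> ennreal (norm h) * ennreal (norm (v \<omega> - s i \<omega>))"
        by (subst ennreal_mult[symmetric]) (auto intro: ennreal_leI)
    qed
    also have "\<dots> = ennreal (norm h) * (\<integral>\<^sup>+\<omega>. ennreal (norm (v \<omega> - s i \<omega>)) \<partial>M)"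
      by (rule nn_integral_cmult) measurable
    finally show ?thesis .
  qed
  have "(\<lambda>i. ennreal (norm h) * (\<integral>\<^sup>+\<omega>. ennreal (norm (v \<omega> - s i \<omega>)) \<partial>M)) \<longlonglongrightarrow> ennreal (norm h) * 0"
    using s unfolding bochner_approx_def by (intro ennreal_tendsto_cmult) auto
  then have "(\<lambda>i. ennreal \<bar>(\<integral>\<omega>. v \<omega> \<bullet> h \<partial>M) - (\<integral>\<omega>. s i \<omega> \<bullet> h \<partial>M)\<bar>) \<longlonglongrightarrow> ennreal 0"
    unfolding mult_zero_right ennreal_0
    by (rule tendsto_sandwich[OF _ _ tendsto_const, rotated 2]) (simp_all add: bound)
  then have "(\<lambda>i. \<bar>(\<integral>\<omega>. v \<omega> \<bullet> h \<partial>M) - (\<integral>\<omega>. s i \<omega> \<bullet> h \<partial>M)\<bar>) \<longlonglongrightarrow> 0"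
    by (subst (asm) tendsto_ennreal_iff) auto
  then have "(\<lambda>i. (\<integral>\<omega>. v \<omega> \<bullet> h \<partial>M) - (\<integral>\<omega>. s i \<omega> \<bullet> h \<partial>M)) \<longlonglongrightarrow> 0"
    by (simp only: tendsto_rabs_zero_iff)
  from tendsto_diff[OF tendsto_const[of "\<integral>\<omega>. v \<omega> \<bullet> h \<partial>M"] this]
  have "(\<lambda>i. \<integral>\<omega>. s i \<omega> \<bullet> h \<partial>M) \<longlonglongrightarrow> (\<integral>\<omega>. v \<omega> \<bullet> h \<partial>M)"
    by simp
  then show ?thesis
    by (simp add: eq)
qed

text \<open>
  The dominated simple approximants converge in mean, so their integrals form a Cauchy sequence;
  completeness of the space provides the value of the integral.
\<close>

lemma ex_convergent_bochner_approx:
  fixes v :: "'a \<Rightarrow> 'h::{real_normed_vector, complete_space}"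
  assumes v: "bochner_measurable M v" and int: "integrable M (\<lambda>\<omega>. norm (v \<omega>))"
  shows "\<exists>s x. bochner_approx M v s \<and>
    (\<lambda>i. Bochner_Integration.simple_bochner_integral M (s i)) \<longlonglongrightarrow> x"
proof -
  obtain t where t: "\<And>n. simple_function M (t n)" "\<And>n \<omega>. norm (t n \<omega>) \<le> 2 * norm (v \<omega>)"
    "AE \<omega> in M. (\<lambda>n. t n \<omega>) \<longlonglongrightarrow> v \<omega>"
    using bochner_measurable_dominated_simple[OF v] by blast
  define I where "I i = Bochner_Integration.simple_bochner_integral M (t i)" for i
  define a where "a i = (\<integral>\<omega>. norm (v \<omega> - t i \<omega>) \<partial>M)" for i
  have [measurable]: "(\<lambda>\<omega>. norm (v \<omega> - t i \<omega>)) \<in> borel_measurable M" for i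
    by (rule borel_measurable_bochner_simple[OF v t(1)]) (intro continuous_intros)
  have le: "norm (v \<omega> - t i \<omega>) \<le> 3 * norm (v \<omega>)" for i \<omega>
    using norm_triangle_ineq4[of "v \<omega>" "t i \<omega>"] t(2)[of i \<omega>] by linarith
  have inti: "integrable M (\<lambda>\<omega>. norm (v \<omega> - t i \<omega>))" for i
    by (rule Bochner_Integration.integrable_bound[OF integrable_mult_right[OF int, of 3]])
      (use le in auto)
  have "a \<longlonglongrightarrow> (\<integral>\<omega>. 0 \<partial>M)"
    unfolding a_def
  proof (rule integral_dominated_convergence[where w = "\<lambda>\<omega>. 3 * norm (v \<omega>)"])
    show "AE \<omega> in M. (\<lambda>i. norm (v \<omega> - t i \<omega>)) \<longlonglongrightarrow> 0"
      using t(3)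
    proof eventually_elim
      case (elim \<omega>)
      then have "(\<lambda>i. norm (v \<omega> - t i \<omega>)) \<longlonglongrightarrow> norm (v \<omega> - v \<omega>)"
        by (intro tendsto_intros)
      then show ?case by simp
    qed
  qed (use int le in auto)
  then have a: "a \<longlonglongrightarrow> 0" by simp
  have "bochner_approx M v t"
    unfolding bochner_approx_def
  proof
    show "\<forall>i. Bochner_Integration.simple_bochner_integrable M (t i)"
      by (simp add: simple_bochner_integrable_iff t)
    have "(\<integral>\<^sup>+\<omega>. ennreal (norm (v \<omega> - t i \<omega>)) \<partial>M) = ennreal (a i)" for i
      unfolding a_def by (rule nn_integral_eq_integral[OF inti]) simp
    then show "(\<lambda>i. \<integral>\<^sup>+\<omega>. ennreal (norm (v \<omega> - t i \<omega>)) \<partial>M) \<longlonglongrightarrow> 0"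
      using tendsto_ennrealI[OF a] by simp
  qed
  moreover have "convergent I"
  proof (rule Cauchy_convergent, rule metric_CauchyI)
    have IJ: "norm (I i - I j) \<le> a i + a j" for i j
    proof -
      have sbi: "Bochner_Integration.simple_bochner_integrable M (\<lambda>\<omega>. norm (t i \<omega> - t j \<omega>))"
        unfolding simple_bochner_integrable_iff by (rule simple_function_compose2[OF t(1) t(1)])
      have "I i - I j = Bochner_Integration.simple_bochner_integral M (\<lambda>\<omega>. t i \<omega> - t j \<omega>)"
        unfolding I_def
        by (rule Bochner_Integration.simple_bochner_integral_diff[symmetric])
          (simp_all add: simple_bochner_integrable_iff t)
      also have "norm \<dots> \<le> Bochner_Integration.simple_bochner_integral M (\<lambda>\<omega>. norm (t i \<omega> - t j \<omega>))"
        by (rule Bochner_Integration.simple_bochner_integral_norm_bound)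
          (simp add: simple_bochner_integrable_iff simple_function_compose2[OF t(1) t(1)])
      also have "\<dots> = (\<integral>\<omega>. norm (t i \<omega> - t j \<omega>) \<partial>M)"
        by (rule simple_bochner_integrable_eq_integral[OF sbi])
      also have "\<dots> \<le> (\<integral>\<omega>. norm (v \<omega> - t i \<omega>) + norm (v \<omega> - t j \<omega>) \<partial>M)"
      proof (rule integral_mono)
        show "integrable M (\<lambda>\<omega>. norm (t i \<omega> - t j \<omega>))"
          using has_bochner_integral_simple_bochner_integrable[OF sbi] by (rule integrable.intros)
        show "norm (t i \<omega> - t j \<omega>) \<le> norm (v \<omega> - t i \<omega>) + norm (v \<omega> - t j \<omega>)" for \<omega>
          using norm_triangle_ineq4[of "v \<omega> - t j \<omega>" "v \<omega> - t i \<omega>"] by simp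
      qed (intro Bochner_Integration.integrable_add inti)
      also have "\<dots> = a i + a j"
        unfolding a_def by (intro Bochner_Integration.integral_add inti)
      finally show ?thesis .
    qed
    fix e :: real assume "0 < e"
    then have "eventually (\<lambda>i. a i < e / 2) sequentially"
      by (intro order_tendstoD(2)[OF a]) simp
    then obtain N where "\<And>i. i \<ge> N \<Longrightarrow> a i < e / 2"
      by (auto simp: eventually_sequentially)
    then have "dist (I m) (I n) < e" if "m \<ge> N" "n \<ge> N" for m n
      using IJ[of m n] \<open>\<And>i. i \<ge> N \<Longrightarrow> a i < e / 2\<close>[OF that(1)]
        \<open>\<And>i. i \<ge> N \<Longrightarrow> a i < e / 2\<close>[OF that(2)]
      by (simp add: dist_norm)
    then show "\<exists>N. \<forall>m\<ge>N. \<forall>n\<ge>N. dist (I m) (I n) < e"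
      by blast
  qed
  ultimately show ?thesis
    unfolding convergent_def I_def by blast
qed

lemma bochner_integral_weak:
  fixes v :: "'a \<Rightarrow> 'h::{real_inner, complete_space}"
  assumes v: "bochner_measurable M v" and int: "integrable M (\<lambda>\<omega>. norm (v \<omega>))"
  shows "bochner_integral M v \<bullet> h = (\<integral>\<omega>. v \<omega> \<bullet> h \<partial>M)"
proof -
  define lim where "lim x \<longleftrightarrow> (\<exists>s. bochner_approx M v s \<and>
    (\<lambda>i. Bochner_Integration.simple_bochner_integral M (s i)) \<longlonglongrightarrow> x)" for x
  have weak: "x \<bullet> h = (\<integral>\<omega>. v \<omega> \<bullet> h \<partial>M)" if x: "lim x" for x h
  proof -
    obtain s where s: "bochner_approx M v s"
      and lim_s: "(\<lambda>i. Bochner_Integration.simple_bochner_integral M (s i)) \<longlonglongrightarrow> x"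
      using x unfolding lim_def by blast
    show ?thesis
      by (rule LIMSEQ_unique[OF tendsto_inner[OF lim_s tendsto_const] bochner_approx_weak_limit[OF v int s]])
  qed
  have "\<exists>!x. lim x"
  proof (rule ex_ex1I)
    show "\<exists>x. lim x"
      unfolding lim_def using ex_convergent_bochner_approx[OF v int] by blast
    show "x = y" if "lim x" "lim y" for x y
      using weak[OF that(1)] weak[OF that(2)] by (intro vector_eq_rdot[THEN iffD1]) simp
  qed
  then have "lim (bochner_integral M v)"
    unfolding bochner_integral_def lim_def by (rule theI')
  then show ?thesis
    by (rule weak)
qed

lemma L2_space_iff:
  "v \<in> L2_space M \<longleftrightarrow> bochner_measurable M v \<and> integrable M (\<lambda>\<omega>. (norm (v \<omega>))\<^sup>2)"
proof -
  have "(\<lambda>\<omega>. (norm (v \<omega>))\<^sup>2) \<in> borel_measurable M" if "bochner_measurable M v"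
    by (rule borel_measurable_bochner[OF that]) (intro continuous_intros)
  then show ?thesis
    unfolding L2_space_def by (auto simp: integrable_iff_bounded)
qed

lemma L2_space_integrable_norm:
  assumes "v \<in> L2_space M"
  shows "integrable M (\<lambda>\<omega>. norm (v \<omega>))"
proof (rule Bochner_Integration.integrable_bound)
  show "integrable M (\<lambda>\<omega>. 1 + (norm (v \<omega>))\<^sup>2)"
    using assms unfolding L2_space_iff by (intro Bochner_Integration.integrable_add) auto
  show "(\<lambda>\<omega>. norm (v \<omega>)) \<in> borel_measurable M"
    using assms unfolding L2_space_iff
    by (intro borel_measurable_bochner) (auto intro: continuous_intros)
  have "x \<le> 1 + x\<^sup>2" for x :: real
    using sum_power2_ge_zero[of "x - 1" x] by (simp add: power2_diff)
  then show "AE \<omega> in M. norm (norm (v \<omega>)) \<le> norm (1 + (norm (v \<omega>))\<^sup>2)"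
    by simp
qed

text \<open>
  Centred functions, partial sums and remainders are all images of one square-integrable function
  under continuous maps of this kind, so membership in the function space is settled at once.
\<close>

lemma L2_space_affine_growth:
  fixes v :: "'a \<Rightarrow> 'h::real_inner" and g :: "'h \<Rightarrow> 'k::real_inner"
  assumes v: "v \<in> L2_space M" and g: "continuous_on UNIV g"
    and le: "\<And>x. norm (g x) \<le> a * norm x + c"
  shows "(\<lambda>\<omega>. g (v \<omega>)) \<in> L2_space M"
  unfolding L2_space_iff
proof
  have bm: "bochner_measurable M v" using v by (simp add: L2_space_iff)
  then show "bochner_measurable M (\<lambda>\<omega>. g (v \<omega>))"
    using g by (rule bochner_measurable_continuous)
  show "integrable M (\<lambda>\<omega>. (norm (g (v \<omega>)))\<^sup>2)"
  proof (rule Bochner_Integration.integrable_bound)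
    show "integrable M (\<lambda>\<omega>. 2 * a\<^sup>2 * (norm (v \<omega>))\<^sup>2 + 2 * c\<^sup>2)"
      using v unfolding L2_space_iff by auto
    show "(\<lambda>\<omega>. (norm (g (v \<omega>)))\<^sup>2) \<in> borel_measurable M"
      by (rule borel_measurable_bochner[OF bm]) (intro continuous_intros g)
    have "(norm (g x))\<^sup>2 \<le> 2 * a\<^sup>2 * (norm x)\<^sup>2 + 2 * c\<^sup>2" for x
    proof -
      have "(norm (g x))\<^sup>2 \<le> (a * norm x + c)\<^sup>2"
        by (intro power_mono le) simp
      also have "\<dots> \<le> 2 * a\<^sup>2 * (norm x)\<^sup>2 + 2 * c\<^sup>2"
        using zero_le_power2[of "a * norm x - c"]
        by (simp add: power2_sum power2_diff power_mult_distrib)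
      finally show ?thesis .
    qed
    then show "AE \<omega> in M. norm ((norm (g (v \<omega>)))\<^sup>2) \<le> norm (2 * a\<^sup>2 * (norm (v \<omega>))\<^sup>2 + 2 * c\<^sup>2)"
      by simp
  qed
qed

end

section \<open>The covariance form\<close>

text \<open>
  The values \<open>X n \<bullet> d\<close> for \<open>d\<close> in a countable set form a point of a countable product of compact
  intervals, which is sequentially compact.
\<close>

lemma subsequence_convergent_inner:
  fixes X :: "nat \<Rightarrow> 'h::real_inner"
  assumes X: "\<And>n. norm (X n) \<le> 1" and D: "countable D"
  shows "\<exists>\<rho>::nat \<Rightarrow> nat. strict_mono \<rho> \<and> (\<forall>d\<in>D. convergent (\<lambda>n. X (\<rho> n) \<bullet> d))"
proof -
  define d where "d = from_nat_into (insert 0 D)"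
  have range_d: "range d = insert 0 D"
    unfolding d_def using D by (intro range_from_nat_into) auto
  define K :: "(nat \<Rightarrow> real) set" where "K = PiE UNIV (\<lambda>i. cball 0 (norm (d i)))"
  have "compactin (product_topology (\<lambda>i::nat. euclidean :: real topology) UNIV) K"
    unfolding K_def by (subst compactin_PiE) auto
  then have "compact K"
    by (simp add: euclidean_product_topology)
  then have K: "seq_compact K"
    by (rule compact_imp_seq_compact)
  have "\<bar>X n \<bullet> d i\<bar> \<le> norm (d i)" for n i
    using Cauchy_Schwarz_ineq2[of "X n" "d i"] mult_right_mono[OF X[of n], of "norm (d i)"] by simp
  then have in_K: "\<forall>n. (\<lambda>i. X n \<bullet> d i) \<in> K"
    by (simp add: K_def PiE_iff)
  obtain l \<rho> where \<rho>: "strict_mono \<rho>" and lim: "((\<lambda>n i. X n \<bullet> d i) \<circ> \<rho>) \<longlonglongrightarrow> l"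
    using K[unfolded seq_compact_def, THEN spec, THEN mp, OF in_K] by blast
  have "(\<lambda>n. X (\<rho> n) \<bullet> d i) \<longlonglongrightarrow> l i" for i
    using continuous_on_tendsto_compose[OF continuous_on_product_coordinates[of i] lim]
    by (simp add: comp_def)
  then have "\<forall>d\<in>range d. convergent (\<lambda>n. X (\<rho> n) \<bullet> d)"
    by (auto simp: convergent_def)
  with \<rho> show ?thesis
    unfolding range_d by blast
qed

context complete_prob_space
begin

lemma L2_inner_measurable [measurable]:
  "w \<in> L2_space M \<Longrightarrow> (\<lambda>\<omega>. w \<omega> \<bullet> h) \<in> borel_measurable M"
  using borel_measurable_bochner[of w "\<lambda>x. x \<bullet> h"]
  by (simp add: L2_space_iff continuous_intros)

lemma integrable_inner_mult_inner:
  assumes w: "w \<in> L2_space M"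
  shows "integrable M (\<lambda>\<omega>. (w \<omega> \<bullet> g) * (w \<omega> \<bullet> h))"
proof (rule Bochner_Integration.integrable_bound)
  show "integrable M (\<lambda>\<omega>. norm g * norm h * (norm (w \<omega>))\<^sup>2)"
    using w by (simp add: L2_space_iff)
  show "(\<lambda>\<omega>. (w \<omega> \<bullet> g) * (w \<omega> \<bullet> h)) \<in> borel_measurable M"
    by (intro borel_measurable_times L2_inner_measurable w)
  have "\<bar>x \<bullet> g\<bar> * \<bar>x \<bullet> h\<bar> \<le> norm g * norm h * (norm x)\<^sup>2" for x
    using mult_mono[OF Cauchy_Schwarz_ineq2[of x g] Cauchy_Schwarz_ineq2[of x h]]
    by (simp add: power2_eq_square mult_ac)
  then show "AE \<omega> in M. norm ((w \<omega> \<bullet> g) * (w \<omega> \<bullet> h)) \<le> norm (norm g * norm h * (norm (w \<omega>))\<^sup>2)"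
    by (simp add: abs_mult)
qed

lemma integrable_inner:
  assumes w: "w \<in> L2_space M"
  shows "integrable M (\<lambda>\<omega>. w \<omega> \<bullet> h)"
proof (rule Bochner_Integration.integrable_bound)
  show "integrable M (\<lambda>\<omega>. norm (w \<omega>) * norm h)"
    using L2_space_integrable_norm[OF w] by simp
qed (use w in \<open>auto simp: Cauchy_Schwarz_ineq2\<close>)

text \<open>
  The bilinear form of the covariance operator, that is of \<open>T\<^sup>* T\<close> for the operator \<open>T\<close> taking
  \<open>h\<close> to the random variable \<open>\<omega> \<mapsto> w \<omega> \<bullet> h\<close>.
\<close>

definition covariance :: "('a \<Rightarrow> 'h::real_inner) \<Rightarrow> 'h \<Rightarrow> 'h \<Rightarrow> real" where
  "covariance w g h = (\<integral>\<omega>. (w \<omega> \<bullet> g) * (w \<omega> \<bullet> h) \<partial>M)"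

text \<open>
  The variance of \<open>\<bar>w \<bullet> h\<bar>\<close> is nonnegative.
\<close>

lemma integral_abs_inner_le:
  assumes w: "w \<in> L2_space M"
  shows "(\<integral>\<omega>. \<bar>w \<omega> \<bullet> h\<bar> \<partial>M) \<le> sqrt (covariance w h h)"
proof (rule real_le_rsqrt)
  have int: "integrable M (\<lambda>\<omega>. \<bar>w \<omega> \<bullet> h\<bar>)"
    by (intro integrable_abs integrable_inner w)
  have sq: "(\<lambda>\<omega>. \<bar>w \<omega> \<bullet> h\<bar>\<^sup>2) = (\<lambda>\<omega>. (w \<omega> \<bullet> h) * (w \<omega> \<bullet> h))"
    by (simp add: power2_eq_square)
  have "integrable M (\<lambda>\<omega>. \<bar>w \<omega> \<bullet> h\<bar>\<^sup>2)"
    unfolding sq by (rule integrable_inner_mult_inner[OF w])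
  from variance_eq[OF int this] variance_positive[of "\<lambda>\<omega>. \<bar>w \<omega> \<bullet> h\<bar>"]
  show "(\<integral>\<omega>. \<bar>w \<omega> \<bullet> h\<bar> \<partial>M)\<^sup>2 \<le> covariance w h h"
    unfolding covariance_def sq by linarith
qed

lemma bounded_bilinear_covariance:
  assumes w: "w \<in> L2_space M"
  shows "bounded_bilinear (covariance w)"
proof
  note int = integrable_inner_mult_inner[OF w]
  show "covariance w (g + g') h = covariance w g h + covariance w g' h" for g g' h
    by (simp add: covariance_def inner_add_right distrib_right int)
  show "covariance w g (h + h') = covariance w g h + covariance w g h'" for g h h'
    by (simp add: covariance_def inner_add_right distrib_left int)
  show "covariance w (c *\<^sub>R g) h = c *\<^sub>R covariance w g h" for c g h
    by (simp add: covariance_def mult.assoc)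
  show "covariance w g (c *\<^sub>R h) = c *\<^sub>R covariance w g h" for c g h
    by (simp add: covariance_def mult.left_commute)
  show "\<exists>K. \<forall>g h. norm (covariance w g h) \<le> norm g * norm h * K"
  proof (intro exI allI)
    fix g h
    have "norm (covariance w g h) \<le> (\<integral>\<omega>. norm ((w \<omega> \<bullet> g) * (w \<omega> \<bullet> h)) \<partial>M)"
      unfolding covariance_def by (rule integral_norm_bound)
    also have "\<dots> \<le> (\<integral>\<omega>. norm g * norm h * (norm (w \<omega>))\<^sup>2 \<partial>M)"
    proof (rule integral_mono)
      show "integrable M (\<lambda>\<omega>. norm ((w \<omega> \<bullet> g) * (w \<omega> \<bullet> h)))"
        by (intro integrable_norm int)
      show "integrable M (\<lambda>\<omega>. norm g * norm h * (norm (w \<omega>))\<^sup>2)"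
        using w by (simp add: L2_space_iff)
      show "norm ((w \<omega> \<bullet> g) * (w \<omega> \<bullet> h)) \<le> norm g * norm h * (norm (w \<omega>))\<^sup>2" for \<omega>
        using mult_mono[OF Cauchy_Schwarz_ineq2[of "w \<omega>" g] Cauchy_Schwarz_ineq2[of "w \<omega>" h]]
        by (simp add: power2_eq_square mult_ac abs_mult)
    qed
    also have "\<dots> = norm g * norm h * (\<integral>\<omega>. (norm (w \<omega>))\<^sup>2 \<partial>M)"
      by simp
    finally show "norm (covariance w g h) \<le> norm g * norm h * (\<integral>\<omega>. (norm (w \<omega>))\<^sup>2 \<partial>M)" .
  qed
qed

text \<open>
  Although the space may be non-separable, \<open>w\<close> takes almost all of its values in the closure of the
  countable set \<open>D\<close> of values of its simple approximants. Convergence of \<open>X (\<rho> n) \<bullet> d\<close> on \<open>D\<close>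
  extends to the closure because the \<open>X n\<close> are bounded.
\<close>

lemma AE_convergent_inner_subsequence:
  fixes w :: "'a \<Rightarrow> 'h::real_inner"
  assumes w: "bochner_measurable M w" and X: "\<And>n. norm (X n) \<le> 1"
  shows "\<exists>\<rho>::nat \<Rightarrow> nat. strict_mono \<rho> \<and> (AE \<omega> in M. convergent (\<lambda>n. w \<omega> \<bullet> X (\<rho> n)))"
proof -
  obtain s where s: "\<And>n. simple_function M (s n)" "AE \<omega> in M. (\<lambda>n. s n \<omega>) \<longlonglongrightarrow> w \<omega>"
    using w unfolding bochner_measurable_iff by blast
  define D where "D = (\<Union>n. s n ` space M)"
  have "countable D"
    unfolding D_def using simple_functionD(1)[OF s(1)] by (auto intro: countable_finite)
  then obtain \<rho> :: "nat \<Rightarrow> nat" where \<rho>: "strict_mono \<rho>"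
    "\<And>d. d \<in> D \<Longrightarrow> convergent (\<lambda>n. X (\<rho> n) \<bullet> d)"
    using subsequence_convergent_inner[of X D] X by blast
  have "AE \<omega> in M. convergent (\<lambda>n. w \<omega> \<bullet> X (\<rho> n))"
    using s(2) AE_space
  proof eventually_elim
    case (elim \<omega>)
    have "Cauchy (\<lambda>n. w \<omega> \<bullet> X (\<rho> n))"
    proof (rule metric_CauchyI)
      fix e :: real assume e: "0 < e"
      obtain k where "dist (s k \<omega>) (w \<omega>) < e / 3"
        using elim(1) e unfolding lim_sequentially by (meson divide_pos_pos le_refl zero_less_numeral)
      then have k: "norm (w \<omega> - s k \<omega>) < e / 3"
        by (simp add: dist_norm norm_minus_commute)
      have near: "\<bar>w \<omega> \<bullet> X n - X n \<bullet> s k \<omega>\<bar> < e / 3" for n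
      proof -
        have "\<bar>(w \<omega> - s k \<omega>) \<bullet> X n\<bar> \<le> norm (w \<omega> - s k \<omega>) * norm (X n)"
          by (rule Cauchy_Schwarz_ineq2)
        also have "\<dots> \<le> norm (w \<omega> - s k \<omega>) * 1"
          by (intro mult_left_mono X) simp
        finally show ?thesis
          using k by (simp add: inner_diff_left inner_commute[of "X n"])
      qed
      have "s k \<omega> \<in> D"
        using elim(2) by (auto simp: D_def)
      then have "Cauchy (\<lambda>n. X (\<rho> n) \<bullet> s k \<omega>)"
        using \<rho>(2) by (intro convergent_Cauchy)
      then obtain N where N: "\<And>m n. m \<ge> N \<Longrightarrow> n \<ge> N \<Longrightarrow>
          dist (X (\<rho> m) \<bullet> s k \<omega>) (X (\<rho> n) \<bullet> s k \<omega>) < e / 3"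
        using e unfolding Cauchy_def by (meson divide_pos_pos zero_less_numeral)
      have "dist (w \<omega> \<bullet> X (\<rho> m)) (w \<omega> \<bullet> X (\<rho> n)) < e" if "m \<ge> N" "n \<ge> N" for m n
        using N[OF that] near[of "\<rho> m"] near[of "\<rho> n"] unfolding dist_real_def by linarith
      then show "\<exists>N. \<forall>m\<ge>N. \<forall>n\<ge>N. dist (w \<omega> \<bullet> X (\<rho> m)) (w \<omega> \<bullet> X (\<rho> n)) < e"
        by blast
    qed
    then show ?case by (rule Cauchy_convergent)
  qed
  with \<rho>(1) show ?thesis by blast
qed

text \<open>
  Compactness: along the subsequence the random variables \<open>w \<omega> \<bullet> X (\<rho> n)\<close> converge almost everywhere
  and are dominated by \<open>\<parallel>w \<omega>\<parallel>\<close>, hence they converge in mean square, and the form evaluated at a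
  difference is their squared mean-square distance.
\<close>

lemma compact_psd_form_covariance:
  fixes w :: "'a \<Rightarrow> 'h::{real_inner, complete_space}"
  assumes w: "w \<in> L2_space M"
  shows "compact_psd_form (covariance w)"
proof -
  interpret bounded_bilinear "covariance w"
    by (rule bounded_bilinear_covariance[OF w])
  show ?thesis
  proof
    show "covariance w g h = covariance w h g" for g h
      by (simp add: covariance_def mult.commute)
    show "0 \<le> covariance w g g" for g
      unfolding covariance_def by (rule Bochner_Integration.integral_nonneg) simp
    fix X :: "nat \<Rightarrow> 'h" assume X: "\<And>n. norm (X n) \<le> 1"
    obtain \<rho> :: "nat \<Rightarrow> nat" where \<rho>: "strict_mono \<rho>"
      and conv: "AE \<omega> in M. convergent (\<lambda>n. w \<omega> \<bullet> X (\<rho> n))"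
      using AE_convergent_inner_subsequence[of w X] X w by (auto simp: L2_space_iff)
    define Z where "Z n \<omega> = w \<omega> \<bullet> X (\<rho> n)" for n \<omega>
    define z where "z \<omega> = lim (\<lambda>n. Z n \<omega>)" for \<omega>
    have [measurable]: "Z n \<in> borel_measurable M" for n
      unfolding Z_def by (rule L2_inner_measurable[OF w])
    have [measurable]: "z \<in> borel_measurable M"
      unfolding z_def by measurable
    have lim: "AE \<omega> in M. (\<lambda>n. Z n \<omega>) \<longlonglongrightarrow> z \<omega>"
      using conv by eventually_elim (simp add: Z_def z_def convergent_LIMSEQ_iff)
    have Z_le: "\<bar>Z n \<omega>\<bar> \<le> norm (w \<omega>)" for n \<omega>
      using Cauchy_Schwarz_ineq2[of "w \<omega>" "X (\<rho> n)"] mult_left_mono[OF X[of "\<rho> n"], of "norm (w \<omega>)"]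
      by (simp add: Z_def)
    have bound: "AE \<omega> in M. norm ((Z n \<omega> - z \<omega>)\<^sup>2) \<le> 4 * (norm (w \<omega>))\<^sup>2" for n
      using lim
    proof eventually_elim
      case (elim \<omega>)
      have "\<bar>z \<omega>\<bar> \<le> norm (w \<omega>)"
        using Z_le by (intro LIMSEQ_le_const2[OF tendsto_rabs[OF elim]]) auto
      then have "\<bar>Z n \<omega> - z \<omega>\<bar> \<le> 2 * norm (w \<omega>)"
        using Z_le[of n \<omega>] by linarith
      then have "\<bar>Z n \<omega> - z \<omega>\<bar>\<^sup>2 \<le> (2 * norm (w \<omega>))\<^sup>2"
        by (intro power_mono) auto
      then show ?case by (simp add: power_mult_distrib)
    qed
    have lim2: "AE \<omega> in M. (\<lambda>n. (Z n \<omega> - z \<omega>)\<^sup>2) \<longlonglongrightarrow> 0"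
      using lim
    proof eventually_elim
      case (elim \<omega>)
      have "(\<lambda>n. (Z n \<omega> - z \<omega>)\<^sup>2) \<longlonglongrightarrow> (z \<omega> - z \<omega>)\<^sup>2"
        by (intro tendsto_intros elim)
      then show ?case by simp
    qed
    have int4: "integrable M (\<lambda>\<omega>. 4 * (norm (w \<omega>))\<^sup>2)"
      using w by (simp add: L2_space_iff)
    have int: "integrable M (\<lambda>\<omega>. (Z n \<omega> - z \<omega>)\<^sup>2)" for n
      by (rule Bochner_Integration.integrable_bound[OF int4]) (use bound[of n] in auto)
    have "(\<lambda>n. \<integral>\<omega>. (Z n \<omega> - z \<omega>)\<^sup>2 \<partial>M) \<longlonglongrightarrow> (\<integral>\<omega>. 0 \<partial>M)"
      by (rule integral_dominated_convergence[OF _ _ int4 lim2 bound]) measurable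
    then have b: "(\<lambda>n. \<integral>\<omega>. (Z n \<omega> - z \<omega>)\<^sup>2 \<partial>M) \<longlonglongrightarrow> 0"
      by simp
    have le: "covariance w (X (\<rho> m) - X (\<rho> n)) (X (\<rho> m) - X (\<rho> n))
        \<le> 2 * (\<integral>\<omega>. (Z m \<omega> - z \<omega>)\<^sup>2 \<partial>M) + 2 * (\<integral>\<omega>. (Z n \<omega> - z \<omega>)\<^sup>2 \<partial>M)" for m n
    proof -
      have "covariance w (X (\<rho> m) - X (\<rho> n)) (X (\<rho> m) - X (\<rho> n))
          \<le> (\<integral>\<omega>. 2 * (Z m \<omega> - z \<omega>)\<^sup>2 + 2 * (Z n \<omega> - z \<omega>)\<^sup>2 \<partial>M)"
        unfolding covariance_def
      proof (rule integral_mono)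
        show "(w \<omega> \<bullet> (X (\<rho> m) - X (\<rho> n))) * (w \<omega> \<bullet> (X (\<rho> m) - X (\<rho> n)))
            \<le> 2 * (Z m \<omega> - z \<omega>)\<^sup>2 + 2 * (Z n \<omega> - z \<omega>)\<^sup>2" for \<omega>
        proof -
          have "(a - b) * (a - b) \<le> 2 * (a - c)\<^sup>2 + 2 * (b - c)\<^sup>2" for a b c :: real
            using zero_le_power2[of "(a - c) + (b - c)"]
            by (simp add: power2_eq_square algebra_simps)
          then show ?thesis
            by (simp add: Z_def inner_diff_right)
        qed
      qed (intro integrable_inner_mult_inner[OF w] Bochner_Integration.integrable_add
          integrable_mult_right int)+
      also have "\<dots> = 2 * (\<integral>\<omega>. (Z m \<omega> - z \<omega>)\<^sup>2 \<partial>M) + 2 * (\<integral>\<omega>. (Z n \<omega> - z \<omega>)\<^sup>2 \<partial>M)"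
        by (simp add: int)
      finally show ?thesis .
    qed
    have "\<exists>N. \<forall>m\<ge>N. \<forall>n\<ge>N. covariance w (X (\<rho> m) - X (\<rho> n)) (X (\<rho> m) - X (\<rho> n)) < e"
      if "0 < e" for e
    proof -
      have "eventually (\<lambda>n. (\<integral>\<omega>. (Z n \<omega> - z \<omega>)\<^sup>2 \<partial>M) < e / 4) sequentially"
        using that by (intro order_tendstoD(2)[OF b]) simp
      then obtain N where N: "\<And>n. n \<ge> N \<Longrightarrow> (\<integral>\<omega>. (Z n \<omega> - z \<omega>)\<^sup>2 \<partial>M) < e / 4"
        unfolding eventually_sequentially by blast
      have "covariance w (X (\<rho> m) - X (\<rho> n)) (X (\<rho> m) - X (\<rho> n)) < e"
        if "m \<ge> N" "n \<ge> N" for m n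
        using le[of m n] N[OF that(1)] N[OF that(2)] by linarith
      then show ?thesis by blast
    qed
    with \<rho> show "\<exists>\<rho>::nat \<Rightarrow> nat. strict_mono \<rho> \<and> (\<forall>e>0. \<exists>N. \<forall>m\<ge>N. \<forall>n\<ge>N.
        covariance w (X (\<rho> m) - X (\<rho> n)) (X (\<rho> m) - X (\<rho> n)) < e)"
      by blast
  qed
qed

end

section \<open>The Karhunen-Loeve expansion\<close>

text \<open>
  Number of terms of the expansion: a nonincreasing nonnegative sequence is positive exactly on an
  initial segment.
\<close>

definition num_positive :: "(nat \<Rightarrow> real) \<Rightarrow> enat" where
  "num_positive l = (if \<forall>n. 0 < l n then \<infinity> else enat (LEAST n. l n = 0))"

lemma mem_KLE_index_num_positive:
  assumes dec: "decseq l" and nonneg: "\<And>n. 0 \<le> l n"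
  shows "r \<in> KLE_index (num_positive l) \<longleftrightarrow> 1 \<le> r \<and> 0 < l (r - 1)"
proof (cases "\<forall>n. 0 < l n")
  case True
  then show ?thesis by (simp add: KLE_index_def num_positive_def)
next
  case False
  define N where "N = (LEAST n. l n = 0)"
  obtain n where "l n = 0"
    using False nonneg by (metis order_le_less)
  then have N: "l N = 0"
    unfolding N_def by (rule LeastI)
  have "0 < l (r - 1)" if "1 \<le> r" "r \<le> N"
  proof -
    have "r - 1 < N" using that by simp
    then have "l (r - 1) \<noteq> 0"
      unfolding N_def by (rule not_less_Least)
    then show ?thesis using nonneg[of "r - 1"] by linarith
  qed
  moreover have "\<not> 0 < l (r - 1)" if "N < r"
  proof -
    have "N \<le> r - 1" using that by simp
    from decseqD[OF dec this] show ?thesis by (simp add: N)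
  qed
  ultimately show ?thesis
    using False unfolding KLE_index_def num_positive_def N_def[symmetric]
    by (auto simp: not_le[symmetric])
qed

context complete_prob_space
begin

text \<open>
  Indices start at \<open>0\<close> here and are shifted by one in the final expansion. At a padding index
  the eigenvalue is \<open>0\<close> and so is \<open>coeff\<close>.
\<close>

definition coeff :: "('a \<Rightarrow> 'h::{real_inner, complete_space}) \<Rightarrow> nat \<Rightarrow> 'a \<Rightarrow> real" where
  "coeff w r \<omega> = (w \<omega> \<bullet> compact_psd_form.eigvec (covariance w) r) /
     sqrt (compact_psd_form.eigval (covariance w) r)"

context
  fixes w :: "'a \<Rightarrow> 'h::{real_inner, complete_space}"
  assumes w: "w \<in> L2_space M"
begin

interpretation C: compact_psd_form "covariance w"
  by (rule compact_psd_form_covariance[OF w])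

abbreviation "eigvec \<equiv> compact_psd_form.eigvec (covariance w)"
abbreviation "eigval \<equiv> compact_psd_form.eigval (covariance w)"
abbreviation "remainder \<equiv> compact_psd_form.remainder (covariance w)"

lemma continuous_remainder: "continuous_on UNIV (remainder n)"
  unfolding C.remainder_def by (intro continuous_intros)

lemma integrable_norm_remainder: "integrable M (\<lambda>\<omega>. (norm (remainder n (w \<omega>)))\<^sup>2)"
  using L2_space_affine_growth[OF w continuous_remainder, where a = 1 and c = 0] C.norm_remainder_le
  by (simp add: L2_space_iff)

lemma integral_norm_remainder:
  "(\<integral>\<omega>. (norm (remainder n (w \<omega>)))\<^sup>2 \<partial>M) = (\<integral>\<omega>. (norm (w \<omega>))\<^sup>2 \<partial>M) - (\<Sum>r<n. eigval r)"
proof -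
  have int: "integrable M (\<lambda>\<omega>. (w \<omega> \<bullet> eigvec r)\<^sup>2)" for r
    using integrable_inner_mult_inner[OF w] by (simp add: power2_eq_square)
  have "(\<integral>\<omega>. (norm (remainder n (w \<omega>)))\<^sup>2 \<partial>M)
      = (\<integral>\<omega>. (norm (w \<omega>))\<^sup>2 - (\<Sum>r<n. (w \<omega> \<bullet> eigvec r)\<^sup>2) \<partial>M)"
    by (simp only: C.norm_remainder_Pythagoras)
  also have "\<dots> = (\<integral>\<omega>. (norm (w \<omega>))\<^sup>2 \<partial>M) - (\<Sum>r<n. \<integral>\<omega>. (w \<omega> \<bullet> eigvec r)\<^sup>2 \<partial>M)"
    using w int by (simp add: L2_space_iff)
  also have "(\<lambda>r. \<integral>\<omega>. (w \<omega> \<bullet> eigvec r)\<^sup>2 \<partial>M) = eigval"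
    by (simp add: fun_eq_iff C.eigval_def covariance_def power2_eq_square)
  finally show ?thesis .
qed

text \<open>
  The heart of the convergence proof. Write \<open>P\<close> for the projection \<open>remainder n\<close> and let \<open>t\<close> be a
  simple approximation of \<open>w\<close>. Then \<open>\<parallel>P w\<parallel>\<^sup>2 = P w \<bullet> w = w \<bullet> P t + P w \<bullet> (w - t)\<close>. The last term is
  at most \<open>\<parallel>w\<parallel> \<parallel>w - t\<parallel>\<close>, which has small integral independently of \<open>n\<close>. As \<open>t\<close> takes finitely many
  values \<open>y\<close>, the other term is controlled by the numbers \<open>\<integral>\<bar>w \<bullet> P y\<bar> \<le> sqrt (eigval n) * \<parallel>y\<parallel>\<close>,
  which tend to \<open>0\<close>.
\<close>

lemma integral_norm_remainder_tendsto_0: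
  "(\<lambda>n. \<integral>\<omega>. (norm (remainder n (w \<omega>)))\<^sup>2 \<partial>M) \<longlonglongrightarrow> 0"
proof -
  have bm: "bochner_measurable M w" using w by (simp add: L2_space_iff)
  obtain t where t: "\<And>k. simple_function M (t k)" "\<And>k \<omega>. norm (t k \<omega>) \<le> 2 * norm (w \<omega>)"
    "AE \<omega> in M. (\<lambda>k. t k \<omega>) \<longlonglongrightarrow> w \<omega>"
    using bochner_measurable_dominated_simple[OF bm] by blast
  define d where "d k \<omega> = norm (w \<omega>) * norm (w \<omega> - t k \<omega>)" for k \<omega>
  have [measurable]: "d k \<in> borel_measurable M" for k
    using borel_measurable_bochner_simple[OF bm t(1), of "\<lambda>x y. norm x * norm (x - y)"]
    by (simp add: d_def[abs_def] continuous_intros)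
  have d_le: "norm (d k \<omega>) \<le> 3 * (norm (w \<omega>))\<^sup>2" for k \<omega>
  proof -
    have "norm (w \<omega> - t k \<omega>) \<le> 3 * norm (w \<omega>)"
      using norm_triangle_ineq4[of "w \<omega>" "t k \<omega>"] t(2)[of k \<omega>] by linarith
    then have "norm (w \<omega>) * norm (w \<omega> - t k \<omega>) \<le> norm (w \<omega>) * (3 * norm (w \<omega>))"
      by (rule mult_left_mono) simp
    then show ?thesis by (simp add: d_def power2_eq_square)
  qed
  have int3: "integrable M (\<lambda>\<omega>. 3 * (norm (w \<omega>))\<^sup>2)"
    using w by (simp add: L2_space_iff)
  have int_d: "integrable M (d k)" for k
    by (rule Bochner_Integration.integrable_bound[OF int3]) (use d_le in auto)
  have "(\<lambda>k. \<integral>\<omega>. d k \<omega> \<partial>M) \<longlonglongrightarrow> (\<integral>\<omega>. 0 \<partial>M)"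
  proof (rule integral_dominated_convergence[OF _ _ int3])
    show "AE \<omega> in M. (\<lambda>k. d k \<omega>) \<longlonglongrightarrow> 0"
      using t(3)
    proof eventually_elim
      case (elim \<omega>)
      have "(\<lambda>k. d k \<omega>) \<longlonglongrightarrow> norm (w \<omega>) * norm (w \<omega> - w \<omega>)"
        unfolding d_def by (intro tendsto_intros elim)
      then show ?case by simp
    qed
  qed (use d_le in auto)
  then have d0: "(\<lambda>k. \<integral>\<omega>. d k \<omega> \<partial>M) \<longlonglongrightarrow> 0" by simp
  define c where "c k = (\<Sum>y\<in>t k ` space M. norm y)" for k
  \<comment> \<open>The constant \<open>c k\<close> is independent of \<open>n\<close>; so \<open>k\<close> is chosen first and \<open>n\<close> afterwards.\<close>
  have split: "(\<integral>\<omega>. (norm (remainder n (w \<omega>)))\<^sup>2 \<partial>M) \<le> sqrt (eigval n) * c k + (\<integral>\<omega>. d k \<omega> \<partial>M)" for n k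
  proof -
    have fin: "finite (t k ` space M)"
      by (rule simple_functionD(1)[OF t(1)])
    have pointwise: "(norm (remainder n (w \<omega>)))\<^sup>2
        \<le> (\<Sum>y\<in>t k ` space M. \<bar>w \<omega> \<bullet> remainder n y\<bar>) + d k \<omega>" if "\<omega> \<in> space M" for \<omega>
    proof -
      have "(norm (remainder n (w \<omega>)))\<^sup>2
          = remainder n (w \<omega>) \<bullet> t k \<omega> + remainder n (w \<omega>) \<bullet> (w \<omega> - t k \<omega>)"
        by (simp add: C.remainder_inner_self inner_diff_right)
      also have "remainder n (w \<omega>) \<bullet> t k \<omega> \<le> \<bar>w \<omega> \<bullet> remainder n (t k \<omega>)\<bar>"
        by (simp add: C.remainder_inner_commute)
      also have "\<dots> \<le> (\<Sum>y\<in>t k ` space M. \<bar>w \<omega> \<bullet> remainder n y\<bar>)"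
        using that fin
        by (intro member_le_sum[where f = "\<lambda>y. \<bar>w \<omega> \<bullet> remainder n y\<bar>"]) auto
      also have "remainder n (w \<omega>) \<bullet> (w \<omega> - t k \<omega>) \<le> d k \<omega>"
      proof -
        have "remainder n (w \<omega>) \<bullet> (w \<omega> - t k \<omega>) \<le> norm (remainder n (w \<omega>)) * norm (w \<omega> - t k \<omega>)"
          by (rule norm_cauchy_schwarz)
        also have "\<dots> \<le> d k \<omega>"
          unfolding d_def by (intro mult_right_mono C.norm_remainder_le) simp
        finally show ?thesis .
      qed
      finally show ?thesis by simp
    qed
    have int_abs: "integrable M (\<lambda>\<omega>. \<bar>w \<omega> \<bullet> h\<bar>)" for h
      by (intro integrable_abs integrable_inner w)
    have "(\<integral>\<omega>. (norm (remainder n (w \<omega>)))\<^sup>2 \<partial>M)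
        \<le> (\<integral>\<omega>. (\<Sum>y\<in>t k ` space M. \<bar>w \<omega> \<bullet> remainder n y\<bar>) + d k \<omega> \<partial>M)"
      by (intro integral_mono integrable_norm_remainder pointwise
          Bochner_Integration.integrable_add Bochner_Integration.integrable_sum int_abs int_d)
    also have "\<dots> = (\<Sum>y\<in>t k ` space M. \<integral>\<omega>. \<bar>w \<omega> \<bullet> remainder n y\<bar> \<partial>M) + (\<integral>\<omega>. d k \<omega> \<partial>M)"
      by (simp add: int_abs int_d)
    also have "(\<Sum>y\<in>t k ` space M. \<integral>\<omega>. \<bar>w \<omega> \<bullet> remainder n y\<bar> \<partial>M)
        \<le> (\<Sum>y\<in>t k ` space M. sqrt (eigval n) * norm y)"
    proof (rule sum_mono)
      fix y
      have "(\<integral>\<omega>. \<bar>w \<omega> \<bullet> remainder n y\<bar> \<partial>M) \<le> sqrt (covariance w (remainder n y) (remainder n y))"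
        by (rule integral_abs_inner_le[OF w])
      also have "\<dots> \<le> sqrt (eigval n * (norm y)\<^sup>2)"
        by (intro real_sqrt_le_mono C.form_remainder_le)
      also have "\<dots> = sqrt (eigval n) * norm y"
        by (simp add: real_sqrt_mult)
      finally show "(\<integral>\<omega>. \<bar>w \<omega> \<bullet> remainder n y\<bar> \<partial>M) \<le> sqrt (eigval n) * norm y" .
    qed
    finally show ?thesis
      by (simp add: c_def sum_distrib_left)
  qed
  show ?thesis
  proof (rule order_tendstoI)
    fix a :: real assume "a < 0"
    then have "a < (\<integral>\<omega>. (norm (remainder n (w \<omega>)))\<^sup>2 \<partial>M)" for n
      by (rule less_le_trans) (simp add: Bochner_Integration.integral_nonneg)
    then show "eventually (\<lambda>n. a < (\<integral>\<omega>. (norm (remainder n (w \<omega>)))\<^sup>2 \<partial>M)) sequentially"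
      by simp
  next
    fix a :: real assume a: "0 < a"
    have "eventually (\<lambda>k. (\<integral>\<omega>. d k \<omega> \<partial>M) < a / 2) sequentially"
      using a by (intro order_tendstoD(2)[OF d0]) simp
    then obtain k where k: "(\<integral>\<omega>. d k \<omega> \<partial>M) < a / 2"
      unfolding eventually_sequentially by blast
    have "(\<lambda>n. sqrt (eigval n) * c k) \<longlonglongrightarrow> sqrt 0 * c k"
      by (intro tendsto_intros C.eigval_tendsto_0)
    then have "eventually (\<lambda>n. sqrt (eigval n) * c k < a / 2) sequentially"
      using a by (intro order_tendstoD(2)) auto
    then show "eventually (\<lambda>n. (\<integral>\<omega>. (norm (remainder n (w \<omega>)))\<^sup>2 \<partial>M) < a) sequentially"
    proof eventually_elim
      case (elim n)
      then show ?case using split[of n k] k by linarith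
    qed
  qed
qed

lemma eigval_sums: "eigval sums (\<integral>\<omega>. (norm (w \<omega>))\<^sup>2 \<partial>M)"
proof -
  have "(\<lambda>n. (\<integral>\<omega>. (norm (w \<omega>))\<^sup>2 \<partial>M) - (\<integral>\<omega>. (norm (remainder n (w \<omega>)))\<^sup>2 \<partial>M))
      \<longlonglongrightarrow> (\<integral>\<omega>. (norm (w \<omega>))\<^sup>2 \<partial>M) - 0"
    by (intro tendsto_intros integral_norm_remainder_tendsto_0)
  then show ?thesis
    by (simp add: sums_def integral_norm_remainder)
qed

lemma mem_KLE_index: "r \<in> KLE_index (num_positive eigval) \<longleftrightarrow> 1 \<le> r \<and> 0 < eigval (r - 1)"
  by (rule mem_KLE_index_num_positive[OF C.decseq_eigval C.eigval_nonneg])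

text \<open>
  In finite rank the remainder has second moment \<open>(\<integral>\<parallel>w\<parallel>\<^sup>2) - sum of all eigenvalues = 0\<close>.
\<close>

lemma AE_remainder_eq_0:
  assumes "num_positive eigval = enat n"
  shows "AE \<omega> in M. remainder n (w \<omega>) = 0"
proof -
  have "Suc n \<notin> KLE_index (num_positive eigval)"
    by (simp add: KLE_index_def assms)
  then have "\<not> 0 < eigval n"
    using mem_KLE_index[of "Suc n"] by simp
  then have "eigval n = 0"
    using C.eigval_nonneg[of n] by linarith
  then have zero: "eigval r = 0" if "n \<le> r" for r
    using decseqD[OF C.decseq_eigval that] C.eigval_nonneg[of r] by simp
  have "(\<integral>\<omega>. (norm (w \<omega>))\<^sup>2 \<partial>M) = (\<Sum>r<n. eigval r)"
    by (rule sums_unique2[OF eigval_sums sums_finite]) (auto intro: zero)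
  then have "(\<integral>\<omega>. (norm (remainder n (w \<omega>)))\<^sup>2 \<partial>M) = 0"
    by (simp add: integral_norm_remainder)
  then have "AE \<omega> in M. (norm (remainder n (w \<omega>)))\<^sup>2 = 0"
    by (subst (asm) integral_nonneg_eq_0_iff_AE) (auto intro: integrable_norm_remainder)
  then show ?thesis
    by simp
qed

lemma sum_coeff_eigvec:
  "(\<Sum>r=1..n. sqrt (eigval (r - 1)) *\<^sub>R (coeff w (r - 1) \<omega> *\<^sub>R eigvec (r - 1))) 
    = w \<omega> - remainder n (w \<omega>)"
proof -
  have "(\<Sum>r=1..n. sqrt (eigval (r - 1)) *\<^sub>R (coeff w (r - 1) \<omega> *\<^sub>R eigvec (r - 1)))
      = (\<Sum>r<n. sqrt (eigval r) *\<^sub>R (coeff w r \<omega> *\<^sub>R eigvec r))"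
    by (simp add: sum.atLeast1_atMost_eq)
  also have "\<dots> = (\<Sum>r<n. (w \<omega> \<bullet> eigvec r) *\<^sub>R eigvec r)"
  proof (rule sum.cong[OF refl])
    fix r
    show "sqrt (eigval r) *\<^sub>R (coeff w r \<omega> *\<^sub>R eigvec r) = (w \<omega> \<bullet> eigvec r) *\<^sub>R eigvec r"
      using C.eigvec_eq_0_iff[of r] by (cases "eigval r = 0") (simp_all add: coeff_def)
  qed
  finally show ?thesis
    by (simp add: C.remainder_def)
qed

lemma L2_tendsto_sum_coeff_eigvec:
  "L2_tendsto M (\<lambda>n \<omega>. \<Sum>r=1..n. sqrt (eigval (r - 1)) *\<^sub>R (coeff w (r - 1) \<omega> *\<^sub>R eigvec (r - 1))) w"
  unfolding L2_tendsto_def sum_coeff_eigvec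
proof (intro conjI allI)
  show "(\<lambda>\<omega>. w \<omega> - remainder n (w \<omega>)) \<in> L2_space M" for n
  proof (rule L2_space_affine_growth[OF w, where a = 2 and c = 0])
    show "continuous_on UNIV (\<lambda>x. x - remainder n x)"
      by (intro continuous_intros continuous_remainder)
    show "norm (x - remainder n x) \<le> 2 * norm x + 0" for x
      using norm_triangle_ineq4[of x "remainder n x"] C.norm_remainder_le[of n x] by linarith
  qed
  have "L2_norm M (\<lambda>\<omega>. w \<omega> - remainder n (w \<omega>) - w \<omega>)
      = sqrt (\<integral>\<omega>. (norm (remainder n (w \<omega>)))\<^sup>2 \<partial>M)" for n
    by (simp add: L2_norm_def L2_inner_def power2_norm_eq_inner)
  then show "(\<lambda>n. L2_norm M (\<lambda>\<omega>. w \<omega> - remainder n (w \<omega>) - w \<omega>)) \<longlonglongrightarrow> 0"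
    using tendsto_real_sqrt[OF integral_norm_remainder_tendsto_0] by simp
qed (rule w)

lemma coeff_L2_real: "coeff w r \<in> L2_real M"
proof -
  have "integrable M (\<lambda>\<omega>. (w \<omega> \<bullet> eigvec r) * (w \<omega> \<bullet> eigvec r) / eigval r)"
    by (intro integrable_divide_zero integrable_inner_mult_inner[OF w])
  also have "(\<lambda>\<omega>. (w \<omega> \<bullet> eigvec r) * (w \<omega> \<bullet> eigvec r) / eigval r) = (\<lambda>\<omega>. (coeff w r \<omega>)\<^sup>2)"
    using C.eigval_nonneg[of r] by (simp add: coeff_def power_divide power2_eq_square)
  finally have "integrable M (\<lambda>\<omega>. (coeff w r \<omega>)\<^sup>2)" .
  moreover have "coeff w r \<in> borel_measurable M"
    unfolding coeff_def[abs_def] by (intro borel_measurable_divide L2_inner_measurable w) simp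
  ultimately show ?thesis
    by (simp add: L2_real_def integrable_iff_bounded)
qed

lemma L2_inner_coeff:
  assumes "0 < eigval r" "0 < eigval s"
  shows "L2_inner M (coeff w r) (coeff w s) = (if r = s then 1 else 0)"
proof -
  have "L2_inner M (coeff w r) (coeff w s)
      = (\<integral>\<omega>. (w \<omega> \<bullet> eigvec r) * (w \<omega> \<bullet> eigvec s) / (sqrt (eigval r) * sqrt (eigval s)) \<partial>M)"
    by (simp add: L2_inner_def coeff_def)
  also have "\<dots> = covariance w (eigvec r) (eigvec s) / (sqrt (eigval r) * sqrt (eigval s))"
    by (simp add: covariance_def)
  also have "\<dots> = (if r = s then 1 else 0)"
    using assms C.form_eigvec_orthogonal[of r s] by (auto simp: C.eigval_def)
  finally show ?thesis .
qed

lemma has_sum_eigval: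
  "((\<lambda>r. eigval (r - 1)) has_sum (L2_norm M w)\<^sup>2) (KLE_index (num_positive eigval))"
proof -
  have "(eigval has_sum (\<integral>\<omega>. (norm (w \<omega>))\<^sup>2 \<partial>M)) UNIV"
    by (rule sums_nonneg_imp_has_sum[OF eigval_sums C.eigval_nonneg])
  then have "(eigval has_sum (\<integral>\<omega>. (norm (w \<omega>))\<^sup>2 \<partial>M)) {n. 0 < eigval n}"
    by (rule has_sum_cong_neutral[THEN iffD1, rotated 3])
      (use C.eigval_nonneg in \<open>auto simp: order_le_less\<close>)
  moreover have bij: "bij_betw (\<lambda>r. r - 1) (KLE_index (num_positive eigval)) {n. 0 < eigval n}"
    by (rule bij_betw_byWitness[where f' = Suc]) (auto simp: mem_KLE_index)
  ultimately have "((\<lambda>r. eigval (r - 1)) has_sum (\<integral>\<omega>. (norm (w \<omega>))\<^sup>2 \<partial>M)) (KLE_index (num_positive eigval))"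
    by (subst has_sum_reindex_bij_betw[OF bij])
  moreover have "(L2_norm M w)\<^sup>2 = (\<integral>\<omega>. (norm (w \<omega>))\<^sup>2 \<partial>M)"
    by (simp add: L2_norm_def L2_inner_def power2_norm_eq_inner Bochner_Integration.integral_nonneg)
  ultimately show ?thesis by simp
qed

end

lemma is_KLE_eigen_expansion:
  fixes v :: "'a \<Rightarrow> 'h::{real_inner, complete_space}"
  defines "w \<equiv> \<lambda>\<omega>. v \<omega> - bochner_integral M v"
  assumes v: "v \<in> L2_space M"
  shows "is_KLE M v (num_positive (compact_psd_form.eigval (covariance w)))
    (\<lambda>r. compact_psd_form.eigval (covariance w) (r - 1))
    (\<lambda>r. coeff w (r - 1)) (\<lambda>r. compact_psd_form.eigvec (covariance w) (r - 1))"
proof -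
  have w: "w \<in> L2_space M"
    unfolding w_def
  proof (rule L2_space_affine_growth[OF v, where a = 1 and c = "norm (bochner_integral M v)"])
    show "norm (x - bochner_integral M v) \<le> 1 * norm x + norm (bochner_integral M v)" for x
      using norm_triangle_ineq4[of x] by simp
  qed (intro continuous_intros)
  interpret C: compact_psd_form "covariance w"
    by (rule compact_psd_form_covariance[OF w])
  define R where "R = num_positive C.eigval"
  note mem_R = mem_KLE_index[OF w, folded R_def]
  have centred: "(\<integral>\<omega>. w \<omega> \<bullet> h \<partial>M) = 0" for h
    using bochner_integral_weak[of v h] L2_space_integrable_norm[OF v] integrable_inner[OF v] v
    by (simp add: w_def inner_diff_left L2_space_iff prob_space)
  show ?thesis
    unfolding is_KLE_def R_def[symmetric]
  proof (intro conjI ballI impI)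
    show "case R of
        enat n \<Rightarrow> AE \<omega> in M. v \<omega> = bochner_integral M v +
          (\<Sum>r=1..n. sqrt (C.eigval (r - 1)) *\<^sub>R (coeff w (r - 1) \<omega> *\<^sub>R C.eigvec (r - 1)))
      | \<infinity> \<Rightarrow> L2_tendsto M
          (\<lambda>n \<omega>. \<Sum>r=1..n. sqrt (C.eigval (r - 1)) *\<^sub>R (coeff w (r - 1) \<omega> *\<^sub>R C.eigvec (r - 1)))
          (\<lambda>\<omega>. v \<omega> - bochner_integral M v)"
    proof (cases R)
      case (enat n)
      have "AE \<omega> in M. v \<omega> = bochner_integral M v +
          (\<Sum>r=1..n. sqrt (C.eigval (r - 1)) *\<^sub>R (coeff w (r - 1) \<omega> *\<^sub>R C.eigvec (r - 1)))"
        using AE_remainder_eq_0[OF w enat[unfolded R_def]] unfolding sum_coeff_eigvec[OF w]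
        by eventually_elim (simp add: w_def)
      then show ?thesis by (simp add: enat)
    next
      case infinity
      then show ?thesis
        using L2_tendsto_sum_coeff_eigvec[OF w] by (simp add: w_def)
    qed
  next
    fix r assume "r \<in> KLE_index R"
    then show "0 < C.eigval (r - 1)"
      by (simp add: mem_R)
  next
    fix r s :: nat assume "r \<le> s"
    then show "C.eigval (s - 1) \<le> C.eigval (r - 1)"
      by (intro decseqD[OF C.decseq_eigval] diff_le_mono)
  next
    show "((\<lambda>r. C.eigval (r - 1)) has_sum (L2_norm M (\<lambda>\<omega>. v \<omega> - bochner_integral M v))\<^sup>2)
        (KLE_index R)"
      using has_sum_eigval[OF w] by (simp add: w_def R_def)
  next
    fix r
    show "coeff w (r - 1) \<in> L2_real M"
      by (rule coeff_L2_real[OF w])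
    show "(\<integral>\<omega>. coeff w (r - 1) \<omega> \<partial>M) = 0"
      by (simp add: coeff_def centred)
  next
    fix r s assume rs: "r \<in> KLE_index R" "s \<in> KLE_index R"
    then have pos: "0 < C.eigval (r - 1)" "0 < C.eigval (s - 1)" and eq: "r - 1 = s - 1 \<longleftrightarrow> r = s"
      by (auto simp: mem_R)
    show "L2_inner M (coeff w (r - 1)) (coeff w (s - 1)) = (if r = s then 1 else 0)"
      using L2_inner_coeff[OF w pos] unfolding eq .
    show "C.eigvec (r - 1) \<bullet> C.eigvec (s - 1) = (if r = s then 1 else 0)"
      using C.norm_eigvec[OF pos(1)] C.eigvec_orthogonal[of "r - 1" "s - 1"] eq
      by (auto simp: norm_eq_1)
  qed
qed

end

theorem theorem2p4:
  fixes M :: "'a measure"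
    and v :: "'a \<Rightarrow> 'h::{real_inner, complete_space}"
  assumes "prob_space M"
    and "complete_measure M"
    and "v \<in> L2_space M"
  shows "admits_KLE M v"
proof -
  interpret complete_prob_space M
    using assms(1,2) by (simp add: complete_prob_space_def)
  have "bochner_measurable M v" "integrable M (\<lambda>\<omega>. norm (v \<omega>))"
    using assms(3) by (auto simp: L2_space_iff L2_space_integrable_norm)
  then have "bochner_integrable M v"
    unfolding bochner_integrable_def using ex_convergent_bochner_approx by blast
  then show ?thesis
    unfolding admits_KLE_def using is_KLE_eigen_expansion[OF assms(3)] by blast
qed

end
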